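(* Let $a>0$, $h>0$. The mapping $(0,ah)\ni L\mapsto\mathcal F_{min}(a,h,L)$ is continuous and symmetric around $L=ah/2$. If $h\le a$, then it is strictly decreasing on $(0,ah/2]$, strictly increasing on $[ah/2,ah)$, and its range is $\left[\frac{h^3}{a^2+h^2},h\right)$. Else if $h>a$, then it is strictly decreasing on $(0,a^2/2]$, constant on $[a^2/2,\,ah-a^2/2]$, strictly increasing on $[ah-a^2/2,\,ah)$, and its range is $[h-a/2,h)$.
   Context: For $z\in\mathbb R$, $z_+:=\max\{z,0\}$. For an absolutely continuous curve $\gamma=(\gamma_1,\gamma_2):[0,1]\to\mathbb R^2$ with $|\gamma'(t)|\ne0$ for a.e. $t\in(0,1)$, set $$\mathcal F(\gamma)=\int_0^1\frac{(\gamma_2'(t))_+^3}{(\gamma_1'(t))^2+(\gamma_2'(t))^2}\,dt .$$ For $a>0,h>0,L\in(0,ah)$, $\mathcal A_{a,h,L}$ is the set of $\gamma\in AC([0,1];[0,a]\times[0,h])$ such that $\gamma(0)=(0,0)$, $\gamma(1)=(a,h)$, $\gamma$ is simple, $|\gamma'(t)|\neq0$ for a.e. $t\in(0,1)$, $\gamma_1'(t)\ge0$ for a.e. $t\in(0,1)$, and $\int_0^1\gamma_1(t)\gamma_2'(t)\,dt=ah-L$. $\mathcal F_{min}(a,h,L)$ denotes the minimal value $\min\{\mathcal F(\gamma):\gamma\in\mathcal A_{a,h,L}\}$. Symmetric around $L=ah/2$ means $\mathcal F_{min}(a,h,L)=\mathcal F_{min}(a,h,ah-L)$ for all $L\in(0,ah)$.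 *)

theory Defs
  imports "HOL-Analysis.Analysis"
begin

text \<open>
  The usual epsilon-delta notion. In \<open>\<D> division_of \<Union>\<D>\<close>, \<open>\<D>\<close> ranges over the finite sets of
  compact intervals with pairwise disjoint interiors; for \<open>K = {u..v}\<close> we have \<open>measure lborel K = v - u\<close>,
  \<open>Inf K = u\<close> and \<open>Sup K = v\<close>. (The library's \<open>absolutely_continuous\<close> is about measures.)
\<close>

definition absolutely_continuous_on :: "real set \<Rightarrow> (real \<Rightarrow> 'a::metric_space) \<Rightarrow> bool" where
  "absolutely_continuous_on S f \<longleftrightarrow>
     (\<forall>\<epsilon>>0. \<exists>\<delta>>0. \<forall>\<D>. \<D> division_of \<Union>\<D> \<and> \<Union>\<D> \<subseteq> S \<and> (\<Sum>K\<in>\<D>. measure lborel K) < \<delta> \<longrightarrow>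
        (\<Sum>K\<in>\<D>. dist (f (Inf K)) (f (Sup K))) < \<epsilon>)"

abbreviation velocity :: "(real \<Rightarrow> real \<times> real) \<Rightarrow> real \<Rightarrow> real \<times> real" where
  "velocity \<gamma> t \<equiv> vector_derivative \<gamma> (at t)"

definition curve_functional :: "(real \<Rightarrow> real \<times> real) \<Rightarrow> real" where
  "curve_functional \<gamma> =
     (LINT t:{0..1}|lebesgue.
        (max (snd (velocity \<gamma> t)) 0) ^ 3 / ((fst (velocity \<gamma> t))\<^sup>2 + (snd (velocity \<gamma> t))\<^sup>2))"

text \<open>
  A curve on \<open>[0,1]\<close> is a function on \<open>real\<close> whose values outside \<open>[0,1]\<close> play no role.
  As \<^const>\<open>vector_derivative\<close> is unspecified at points where the derivative does not exist,
  \<open>|\<gamma>'(t)| \<noteq> 0\<close> is spelled out as: \<open>\<gamma>\<close> is differentiable at \<open>t\<close>, with nonzero derivative.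
  (An absolutely continuous curve is differentiable almost everywhere.)
\<close>

definition admissible_curves :: "real \<Rightarrow> real \<Rightarrow> real \<Rightarrow> (real \<Rightarrow> real \<times> real) set" where
  "admissible_curves a h L =
     {\<gamma>. absolutely_continuous_on {0..1} \<gamma> \<and> path_image \<gamma> \<subseteq> {0..a} \<times> {0..h} \<and>
         pathstart \<gamma> = (0, 0) \<and> pathfinish \<gamma> = (a, h) \<and> simple_path \<gamma> \<and>
         (AE t\<in>{0<..<1} in lebesgue. \<gamma> differentiable (at t) \<and> velocity \<gamma> t \<noteq> 0) \<and>
         (AE t\<in>{0<..<1} in lebesgue. fst (velocity \<gamma> t) \<ge> 0) \<and>
         (LINT t:{0..1}|lebesgue. fst (\<gamma> t) * snd (velocity \<gamma> t)) = a * h - L}"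

text \<open>The minimum, not the infimum: \<^const>\<open>Least\<close> is only specified if a least value exists.\<close>

definition F_min :: "real \<Rightarrow> real \<Rightarrow> real \<Rightarrow> real" where
  "F_min a h L = (LEAST v. v \<in> curve_functional ` admissible_curves a h L)"

end

theory Submission
  imports Defs
begin

text \<open>
  Write \<open>f(u, v) = v\<^sub>+^3 / (u^2 + v^2)\<close>. For slopes \<open>s \<in> [0, 1]\<close> the tangent planes of \<open>f\<close> at \<open>(1, s)\<close>
  lie below \<open>f\<close> on the half plane \<open>u \<ge> 0\<close>; in terms of \<open>p = \<partial>f/\<partial>v(1, s)\<close> this reads
  \<open>f(u, v) \<ge> p v - f*(p) u\<close>, with equality also for vertical motion if \<open>p = 1\<close>. Since
  \<open>L = \<integral> y dx\<close>, choosing \<open>p\<close> along the curve as \<open>p(x) = max 0 (q - \<mu> (a - x))\<close> makes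
  \<open>p dy + \<mu> y dx\<close> exact where \<open>p > 0\<close>, and gives \<open>\<F>(\<gamma>) \<ge> q h - \<integral>\<^sub>0\<^sup>a f*(p(x)) dx - \<mu> L\<close> for all
  \<open>\<mu> \<ge> 0\<close> and \<open>q \<in> [0, 1]\<close>. Equality holds for the graph whose slope at \<open>x\<close> corresponds to \<open>p(x)\<close>,
  followed by a vertical segment at \<open>x = a\<close> which is nontrivial only if \<open>q = 1\<close>. By the intermediate
  value theorem in \<open>\<mu>\<close> these curves realise every \<open>L\<close> up to \<open>min (a h) (a^2) / 2\<close>; the larger values
  of \<open>L\<close> are covered by the central symmetry of the rectangle and, if \<open>h > a\<close>, by diagonals of slope
  \<open>1\<close> between two vertical segments. Hence the minimal value has a subgradient at every \<open>L\<close>, which is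
  strictly negative left of the plateau, so that it is convex, continuous and strictly monotone off
  the plateau.
\<close>

section \<open>Absolutely continuous functions\<close>

lemma division_of_real_elemE:
  fixes \<D> :: "real set set"
  assumes "\<D> division_of X" "K \<in> \<D>"
  obtains u v where "u \<le> v" "K = {u..v}" "Inf K = u" "Sup K = v" "u \<in> X" "v \<in> X"
proof -
  obtain u v where K: "K = cbox u v" "K \<noteq> {}" "K \<subseteq> X"
    using division_ofD(2-4)[OF assms] by metis
  show thesis
    by (rule that[of u v]) (use K in auto)
qed

lemma absolutely_continuous_on_subset:
  assumes "absolutely_continuous_on S f" "T \<subseteq> S"
  shows "absolutely_continuous_on T f"
  using assms unfolding absolutely_continuous_on_def by (meson order_trans)

lemma absolutely_continuous_on_lipschitz_compose:
  assumes f: "absolutely_continuous_on S f" and G: "C-lipschitz_on (f ` S) G"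
  shows "absolutely_continuous_on S (\<lambda>x. G (f x))"
  unfolding absolutely_continuous_on_def
proof (intro allI impI)
  fix \<epsilon> :: real assume "\<epsilon> > 0"
  have C: "C \<ge> 0" using G by (rule lipschitz_on_nonneg)
  \<comment> \<open>\<open>C + 1\<close> instead of \<open>C\<close> keeps the quotient meaningful
    when \<open>C = 0\<close>.\<close>
  then have "\<epsilon> / (C + 1) > 0" using \<open>\<epsilon> > 0\<close> by simp
  then obtain \<delta> where \<delta>: "\<delta> > 0" "\<And>\<D>. \<D> division_of \<Union>\<D> \<Longrightarrow> \<Union>\<D> \<subseteq> S \<Longrightarrow>
      (\<Sum>K\<in>\<D>. measure lborel K) < \<delta> \<Longrightarrow> (\<Sum>K\<in>\<D>. dist (f (Inf K)) (f (Sup K))) < \<epsilon> / (C + 1)"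
    using f unfolding absolutely_continuous_on_def by meson
  have "(\<Sum>K\<in>\<D>. dist (G (f (Inf K))) (G (f (Sup K)))) < \<epsilon>"
    if D: "\<D> division_of \<Union>\<D>" "\<Union>\<D> \<subseteq> S" "(\<Sum>K\<in>\<D>. measure lborel K) < \<delta>" for \<D>
  proof -
    have "dist (G (f (Inf K))) (G (f (Sup K))) \<le> C * dist (f (Inf K)) (f (Sup K))" if "K \<in> \<D>" for K
      using division_of_real_elemE[OF D(1) that] D(2) lipschitz_onD[OF G] by (metis imageI subsetD)
    then have "(\<Sum>K\<in>\<D>. dist (G (f (Inf K))) (G (f (Sup K)))) \<le> C * (\<Sum>K\<in>\<D>. dist (f (Inf K)) (f (Sup K)))"
      unfolding sum_distrib_left by (rule sum_mono)
    also have "\<dots> \<le> (C + 1) * (\<Sum>K\<in>\<D>. dist (f (Inf K)) (f (Sup K)))"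
      by (intro mult_right_mono sum_nonneg) auto
    also have "\<dots> < \<epsilon>"
      using \<delta>(2)[OF D] C by (simp add: field_simps)
    finally show ?thesis .
  qed
  then show "\<exists>\<delta>>0. \<forall>\<D>. \<D> division_of \<Union>\<D> \<and> \<Union>\<D> \<subseteq> S \<and> (\<Sum>K\<in>\<D>. measure lborel K) < \<delta> \<longrightarrow>
      (\<Sum>K\<in>\<D>. dist (G (f (Inf K))) (G (f (Sup K)))) < \<epsilon>"
    using \<delta>(1) by blast
qed

lemma absolutely_continuous_on_id: "absolutely_continuous_on S (\<lambda>x. x)"
  unfolding absolutely_continuous_on_def
proof (intro allI impI)
  fix \<epsilon> :: real assume "\<epsilon> > 0"
  have "(\<Sum>K\<in>\<D>. dist (Inf K) (Sup K)) < \<epsilon>"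
    if D: "\<D> division_of \<Union>\<D>" "(\<Sum>K\<in>\<D>. measure lborel K) < \<epsilon>" for \<D> :: "real set set"
  proof -
    have "dist (Inf K) (Sup K) = measure lborel K" if K: "K \<in> \<D>" for K
      by (rule division_of_real_elemE[OF D(1) K]) (simp add: dist_real_def)
    then show ?thesis using D by simp
  qed
  with \<open>\<epsilon> > 0\<close> show "\<exists>\<delta>>0. \<forall>\<D>. \<D> division_of \<Union>\<D> \<and> \<Union>\<D> \<subseteq> S \<and> (\<Sum>K\<in>\<D>. measure lborel K) < \<delta> \<longrightarrow>
      (\<Sum>K\<in>\<D>. dist (Inf K) (Sup K)) < \<epsilon>"
    by blast
qed

lemma lipschitz_imp_absolutely_continuous_on:
  "C-lipschitz_on S f \<Longrightarrow> absolutely_continuous_on S f"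
  using absolutely_continuous_on_lipschitz_compose[OF absolutely_continuous_on_id, of C S f] by simp

text \<open>A single interval is a division, and for it the defining estimate is uniform
  continuity.\<close>

lemma absolutely_continuous_on_imp_continuous_on:
  fixes f :: "real \<Rightarrow> 'a::metric_space"
  assumes "absolutely_continuous_on {a..b} f"
  shows "continuous_on {a..b} f"
  unfolding continuous_on_iff
proof (intro ballI allI impI)
  fix x \<epsilon> :: real assume x: "x \<in> {a..b}" and "\<epsilon> > 0"
  then obtain \<delta> where \<delta>: "\<delta> > 0" "\<And>\<D>. \<D> division_of \<Union>\<D> \<Longrightarrow> \<Union>\<D> \<subseteq> {a..b} \<Longrightarrow>
      (\<Sum>K\<in>\<D>. measure lborel K) < \<delta> \<Longrightarrow> (\<Sum>K\<in>\<D>. dist (f (Inf K)) (f (Sup K))) < \<epsilon>"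
    using assms unfolding absolutely_continuous_on_def by meson
  have *: "dist (f u) (f v) < \<epsilon>" if "u \<le> v" "u \<in> {a..b}" "v \<in> {a..b}" "v - u < \<delta>" for u v
  proof -
    have "{{u..v}} division_of \<Union>{{u..v}}"
      using that division_of_self[of u v] by simp
    from \<delta>(2)[OF this] that show ?thesis by simp
  qed
  have "dist (f y) (f x) < \<epsilon>" if "y \<in> {a..b}" "dist y x < \<delta>" for y
    using *[of x y] *[of y x] x that by (cases "x \<le> y") (auto simp: dist_real_def dist_commute)
  with \<delta>(1) show "\<exists>d>0. \<forall>x'\<in>{a..b}. dist x' x < d \<longrightarrow> dist (f x') (f x) < \<epsilon>"
    by blast
qed

text \<open>
  Riemann sums of the derivative are compared with increments of \<open>f\<close>: tags outside the null set \<open>N\<close>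
  are handled by differentiability, and the intervals tagged in \<open>N\<close> lie in an open set of small measure,
  so that absolute continuity bounds the increments of \<open>f\<close> over them.
\<close>

lemma fundamental_theorem_of_calculus_absolutely_continuous:
  fixes f :: "real \<Rightarrow> 'a::euclidean_space"
  assumes "a \<le> b" and ac: "absolutely_continuous_on {a..b} f" and N: "negligible N"
    and der: "\<And>t. t \<in> {a..b} - N \<Longrightarrow> (f has_vector_derivative f' t) (at t within {a..b})"
  shows "(f' has_integral f b - f a) {a..b}"
proof -
  \<comment> \<open>Setting \<open>f'\<close> to 0 on \<open>N\<close> makes tags in
    \<open>N\<close> contribute nothing to a Riemann sum; the change on a null set is undone at the
    end.\<close>
  define g where "g t = (if t \<in> N then 0 else f' t)" for t
  have "(g has_integral f b - f a) {a..b}"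
    unfolding has_integral_real
  proof (intro allI impI)
    fix e :: real assume "e > 0"
    then have "e / 3 > 0" by simp
    then obtain \<delta> where \<delta>: "\<delta> > 0" "\<And>\<D>. \<D> division_of \<Union>\<D> \<Longrightarrow> \<Union>\<D> \<subseteq> {a..b} \<Longrightarrow>
        (\<Sum>K\<in>\<D>. measure lborel K) < \<delta> \<Longrightarrow> (\<Sum>K\<in>\<D>. dist (f (Inf K)) (f (Sup K))) < e / 3"
      using ac unfolding absolutely_continuous_on_def by meson
    have Nn: "N \<in> null_sets lebesgue" using N by (simp add: negligible_iff_null_sets)
    then obtain U where U: "open U" "N \<subseteq> U" "U - N \<in> lmeasurable"
        "emeasure lebesgue (U - N) < ennreal \<delta>"
      using sets_lebesgue_outer_open[of N \<delta>] \<delta>(1) by blast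
    have Ulm: "U \<in> lmeasurable"
    proof -
      have "U = (U - N) \<union> N" using U(2) by auto
      then show ?thesis using U(3) N negligible_imp_measurable fmeasurable.Un by metis
    qed
    have "measure lebesgue U = measure lebesgue (U - N)"
      using N by (intro measure_negligible_symdiff[symmetric] negligible_subset[OF N]) (use Ulm U in auto)
    also have "\<dots> < \<delta>"
      using U(3,4) \<delta>(1) by (simp add: emeasure_eq_measure2 ennreal_less_iff)
    finally have mU: "measure lebesgue U < \<delta>" .
    \<comment> \<open>The errors at tags outside \<open>N\<close> add up to at most
      \<open>e1 * (b - a)\<close>, hence to at most \<open>e / 3\<close>; the \<open>+ 1\<close>
      covers \<open>a = b\<close>.\<close>
    define e1 where "e1 = e / (3 * (b - a + 1))"
    have "e1 > 0" using \<open>e > 0\<close> \<open>a \<le> b\<close> by (simp add: e1_def)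
    have "\<exists>r>0. (t \<in> N \<longrightarrow> ball t r \<subseteq> U) \<and> (t \<in> {a..b} - N \<longrightarrow>
        (\<forall>y\<in>{a..b}. \<bar>y - t\<bar> < r \<longrightarrow> norm (f y - f t - (y - t) *\<^sub>R f' t) \<le> e1 * \<bar>y - t\<bar>))" for t
    proof (cases "t \<in> N")
      case True
      then show ?thesis using U(1,2) by (meson DiffE openE subsetD)
    next
      case False
      show ?thesis
      proof (cases "t \<in> {a..b}")
        case True
        then have "(f has_derivative (\<lambda>x. x *\<^sub>R f' t)) (at t within {a..b})"
          using der False unfolding has_vector_derivative_def by auto
        then obtain d where "d > 0" "\<And>y. y \<in> {a..b} \<Longrightarrow> norm (y - t) < d \<Longrightarrow>
            norm (f y - f t - (y - t) *\<^sub>R f' t) \<le> e1 * norm (y - t)"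
          using \<open>e1 > 0\<close> unfolding has_derivative_within_alt by meson
        then show ?thesis using False by (intro exI[of _ d]) auto
      next
        case False
        then show ?thesis using \<open>t \<notin> N\<close> by (intro exI[of _ 1]) auto
      qed
    qed
    then obtain r where r: "\<And>t. r t > 0" "\<And>t. t \<in> N \<Longrightarrow> ball t (r t) \<subseteq> U"
       "\<And>t y. t \<in> {a..b} - N \<Longrightarrow> y \<in> {a..b} \<Longrightarrow> \<bar>y - t\<bar> < r t \<Longrightarrow>
           norm (f y - f t - (y - t) *\<^sub>R f' t) \<le> e1 * \<bar>y - t\<bar>"
      by metis
    show "\<exists>\<gamma>. gauge \<gamma> \<and> (\<forall>\<D>. \<D> tagged_division_of {a..b} \<and> \<gamma> fine \<D> \<longrightarrow>
        norm ((\<Sum>(x,k)\<in>\<D>. measure lborel k *\<^sub>R g x) - (f b - f a)) < e)"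
    proof (intro exI[of _ "\<lambda>t. ball t (r t)"] conjI allI impI)
      show "gauge (\<lambda>t. ball t (r t))" using r(1) by (intro gauge_ball_dependent) auto
    next
      fix \<D> assume "\<D> tagged_division_of {a..b} \<and> (\<lambda>t. ball t (r t)) fine \<D>"
      then have td: "\<D> tagged_division_of {a..b}" and fine: "(\<lambda>t. ball t (r t)) fine \<D>" by auto
      note tdD = tagged_division_ofD[OF td]
      define \<E> where "\<E> = {(x,K). (x,K) \<in> \<D> \<and> x \<in> N}"
      have E: "\<E> \<subseteq> \<D>" by (auto simp: \<E>_def)
      have finE: "finite \<E>" using E tdD(1) finite_subset by blast
      have elem: "\<exists>u v. u \<le> v \<and> K = {u..v} \<and> Inf K = u \<and> Sup K = v \<and> x \<in> {u..v} \<and> {u..v} \<subseteq> {a..b} \<and>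
          {u..v} \<subseteq> ball x (r x)" if xK: "(x,K) \<in> \<D>" for x K
      proof -
        obtain u v where K: "K = cbox u v" using tdD(4)[OF xK] by blast
        then have "K = {u..v}" by simp
        moreover have "x \<in> K" "K \<subseteq> {a..b}" using tdD(2,3)[OF xK] by auto
        moreover have "K \<subseteq> ball x (r x)" using fine xK by (auto simp: fine_def)
        ultimately show ?thesis
          by (intro exI[of _ u] exI[of _ v]) auto
      qed
      have good: "norm (measure lborel K *\<^sub>R g x - (f (Sup K) - f (Inf K))) \<le> e1 * measure lborel K"
        if xK: "(x,K) \<in> \<D> - \<E>" for x K
      proof -
        obtain u v where uv: "u \<le> v" "K = {u..v}" "Inf K = u" "Sup K = v" "x \<in> {u..v}" "{u..v} \<subseteq> {a..b}"
          "{u..v} \<subseteq> ball x (r x)" using elem xK by blast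
        have xN: "x \<notin> N" using xK by (auto simp: \<E>_def)
        have in_ab: "x \<in> {a..b} - N" "u \<in> {a..b}" "v \<in> {a..b}" using uv xN by auto
        have "u \<in> ball x (r x)" "v \<in> ball x (r x)" using uv(1,7) by (auto simp del: mem_ball)
        then have *: "norm (f u - f x - (u - x) *\<^sub>R f' x) \<le> e1 * \<bar>u - x\<bar>"
            "norm (f v - f x - (v - x) *\<^sub>R f' x) \<le> e1 * \<bar>v - x\<bar>"
          using r(3)[OF in_ab(1) in_ab(2)] r(3)[OF in_ab(1) in_ab(3)] by (auto simp: dist_real_def)
        have "measure lborel K *\<^sub>R g x - (f (Sup K) - f (Inf K)) =
            (f u - f x - (u - x) *\<^sub>R f' x) - (f v - f x - (v - x) *\<^sub>R f' x)"
          using uv xN by (simp add: g_def algebra_simps)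
        also have "norm \<dots> \<le> e1 * \<bar>u - x\<bar> + e1 * \<bar>v - x\<bar>"
          using * by (meson add_mono norm_triangle_ineq4 order_trans)
        also have "\<dots> = e1 * measure lborel K" using uv by (simp add: algebra_simps)
        finally show ?thesis .
      qed
      have bad: "(\<Sum>(x,K)\<in>\<E>. norm (f (Sup K) - f (Inf K))) < e / 3"
      proof -
        have tE: "\<E> tagged_partial_division_of {a..b}"
          using tagged_partial_division_subset[OF _ E] td by (simp add: tagged_division_of_def)
        then have tE': "\<E> tagged_division_of \<Union>(snd ` \<E>)"
          by (rule tagged_partial_division_of_Union_self)
        have dE: "(snd ` \<E>) division_of \<Union>(snd ` \<E>)"
          by (rule division_of_tagged_division[OF tE'])
        have ne: "(x, {}) \<notin> \<E>" for x using E tdD(2)[of x "{}"] by blast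
        \<comment> \<open>Different tags can share only degenerate intervals, so the sum over pairs
          turns into a sum over intervals once \<open>d\<close> vanishes on those. The empty set
          gets its own value because \<open>Inf\<close> and \<open>Sup\<close> carry no information
          there.\<close>
        define d where "d K = (if K = {} then 0 else norm (f (Sup K) - f (Inf K)))" for K
        have "(\<Sum>(x,K)\<in>\<E>. norm (f (Sup K) - f (Inf K))) = (\<Sum>(x,K)\<in>\<E>. d K)"
          using ne by (intro sum.cong) (auto simp: d_def)
        also have "\<dots> = (\<Sum>K\<in>snd ` \<E>. d K)"
          by (rule sum.over_tagged_division_lemma[OF tE'])
             (auto simp: d_def split: if_splits dest: order_antisym)
        also have "\<dots> = (\<Sum>K\<in>snd ` \<E>. norm (f (Sup K) - f (Inf K)))"
          using ne by (intro sum.cong) (auto simp: d_def)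
        also have "\<dots> = (\<Sum>K\<in>snd ` \<E>. dist (f (Inf K)) (f (Sup K)))"
          by (simp add: dist_norm norm_minus_commute)
        also have "\<dots> < e / 3"
        proof (rule \<delta>(2)[OF dE])
          have "K \<subseteq> {a..b} \<inter> U" if "K \<in> snd ` \<E>" for K
          proof -
            obtain x where "(x, K) \<in> \<D>" "x \<in> N" using \<open>K \<in> snd ` \<E>\<close> by (auto simp: \<E>_def)
            moreover have "K \<subseteq> ball x (r x)" using elem[OF calculation(1)] by blast
            ultimately show ?thesis using tdD(3)[of x K] r(2)[of x] by blast
          qed
          then have sub: "\<Union>(snd ` \<E>) \<subseteq> {a..b}" "\<Union>(snd ` \<E>) \<subseteq> U" by blast+
          show "\<Union>(snd ` \<E>) \<subseteq> {a..b}" by (rule sub)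
          have "(\<Sum>K\<in>snd ` \<E>. measure lborel K) = measure lebesgue (\<Union>(snd ` \<E>))"
          proof -
            have "measure lborel K = measure lebesgue K" if "K \<in> snd ` \<E>" for K
              by (rule division_of_real_elemE[OF dE that]) simp
            then show ?thesis using content_division[OF dE] by simp
          qed
          also have "\<dots> \<le> measure lebesgue U"
          proof (rule measure_mono_fmeasurable[OF _ _ Ulm])
            show "\<Union>(snd ` \<E>) \<subseteq> U" by (rule sub)
            show "\<Union>(snd ` \<E>) \<in> sets lebesgue"
              using dE lmeasurable_division fmeasurableD by blast
          qed
          finally show "(\<Sum>K\<in>snd ` \<E>. measure lborel K) < \<delta>" using mU by simp
        qed
        finally show ?thesis .
      qed
      have "(\<Sum>(x,K)\<in>\<D>. measure lborel K *\<^sub>R g x) - (f b - f a)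
          = (\<Sum>(x,K)\<in>\<D>. measure lborel K *\<^sub>R g x - (f (Sup K) - f (Inf K)))"
        using additive_tagged_division_1[OF \<open>a \<le> b\<close> td, of f]
        by (simp add: case_prod_unfold sum_subtractf)
      also have "norm \<dots> \<le> (\<Sum>(x,K)\<in>\<D>. norm (measure lborel K *\<^sub>R g x - (f (Sup K) - f (Inf K))))"
        by (simp add: case_prod_unfold sum_norm_le)
      also have "\<dots> = (\<Sum>(x,K)\<in>\<D>-\<E>. norm (measure lborel K *\<^sub>R g x - (f (Sup K) - f (Inf K))))
          + (\<Sum>(x,K)\<in>\<E>. norm (measure lborel K *\<^sub>R g x - (f (Sup K) - f (Inf K))))"
        by (rule sum.subset_diff[OF E tdD(1)])
      also have "(\<Sum>(x,K)\<in>\<E>. norm (measure lborel K *\<^sub>R g x - (f (Sup K) - f (Inf K))))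
          = (\<Sum>(x,K)\<in>\<E>. norm (f (Sup K) - f (Inf K)))"
        by (rule sum.cong) (auto simp: \<E>_def g_def norm_minus_commute)
      also have "(\<Sum>(x,K)\<in>\<D>-\<E>. norm (measure lborel K *\<^sub>R g x - (f (Sup K) - f (Inf K))))
          \<le> (\<Sum>(x,K)\<in>\<D>-\<E>. e1 * measure lborel K)"
        using good by (intro sum_mono) auto
      also have "(\<Sum>(x,K)\<in>\<D>-\<E>. e1 * measure lborel K) \<le> (\<Sum>(x,K)\<in>\<D>. e1 * measure lborel K)"
        using \<open>e1 > 0\<close> tdD(1) by (intro sum_mono2) auto
      also have "\<dots> = e1 * (b - a)"
        using additive_content_tagged_division[of \<D> a b] td \<open>a \<le> b\<close>
        by (simp add: case_prod_unfold flip: sum_distrib_left)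
      also have "\<dots> \<le> e / 3"
        using \<open>e > 0\<close> \<open>a \<le> b\<close> by (simp add: e1_def field_simps)
      finally show "norm ((\<Sum>(x,K)\<in>\<D>. measure lborel K *\<^sub>R g x) - (f b - f a)) < e"
        using bad \<open>e > 0\<close> by simp
    qed
  qed
  then show ?thesis
    by (rule has_integral_spike[OF N, rotated]) (auto simp: g_def)
qed

text \<open>On an interval shorter than \<delta> the variation of \<open>f\<close>, the indefinite
  integral of \<open>f'\<close>, is at most 1, and bounded variation of the indefinite integral
  gives absolute integrability. Finitely many such intervals cover \<open>{a..b}\<close>.\<close>

lemma absolutely_continuous_on_derivative_absolutely_integrable:
  fixes f :: "real \<Rightarrow> 'a::euclidean_space"
  assumes ac: "absolutely_continuous_on {a..b} f" and N: "negligible N"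
    and der: "\<And>t. t \<in> {a..b} - N \<Longrightarrow> (f has_vector_derivative f' t) (at t within {a..b})"
  shows "f' absolutely_integrable_on {a..b}"
proof -
  obtain \<delta> where \<delta>: "\<delta> > 0" "\<And>\<D>. \<D> division_of \<Union>\<D> \<Longrightarrow> \<Union>\<D> \<subseteq> {a..b} \<Longrightarrow>
      (\<Sum>K\<in>\<D>. measure lborel K) < \<delta> \<Longrightarrow> (\<Sum>K\<in>\<D>. dist (f (Inf K)) (f (Sup K))) < 1"
    using ac unfolding absolutely_continuous_on_def by (meson zero_less_one)
  have int: "(f' has_integral f v - f u) {u..v}" if "u \<le> v" "{u..v} \<subseteq> {a..b}" for u v
    using that ac N der
    by (intro fundamental_theorem_of_calculus_absolutely_continuous[of _ _ _ N])
       (auto intro: absolutely_continuous_on_subset has_vector_derivative_within_subset[of f _ _ "{a..b}"])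
  have short: "f' absolutely_integrable_on {u..v}"
    if uv: "u \<le> v" "{u..v} \<subseteq> {a..b}" "v - u < \<delta>" for u v
  proof -
    have "f' absolutely_integrable_on cbox u v"
    proof (rule bounded_variation_absolutely_integrable_interval[where B=1])
      show "f' integrable_on cbox u v" using int[OF uv(1,2)] by auto
      fix d assume d: "d division_of cbox u v"
      then have "(\<Sum>K\<in>d. norm (integral K f')) = (\<Sum>K\<in>d. dist (f (Inf K)) (f (Sup K)))"
      proof (intro sum.cong refl)
        fix K assume "K \<in> d"
        with d obtain s t where "s \<le> t" "K = {s..t}" "Inf K = s" "Sup K = t" "s \<in> cbox u v" "t \<in> cbox u v"
          by (rule division_of_real_elemE)
        moreover then have "integral K f' = f t - f s"
          using uv by (intro integral_unique) (auto intro!: int)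
        ultimately show "norm (integral K f') = dist (f (Inf K)) (f (Sup K))"
          by (simp add: dist_norm norm_minus_commute)
      qed
      also have "\<dots> < 1"
      proof (rule \<delta>(2))
        show "d division_of \<Union>d" "\<Union>d \<subseteq> {a..b}" using d uv division_ofD(6)[OF d] by auto
        show "(\<Sum>K\<in>d. measure lborel K) < \<delta>"
          using additive_content_division[OF d] uv by simp
      qed
      finally show "(\<Sum>K\<in>d. norm (integral K f')) \<le> 1" by simp
    qed
    then show ?thesis by simp
  qed
  show ?thesis
  proof (cases "a \<le> b")
    case True
    \<comment> \<open>A grid of step \<open>\<delta> / 2\<close> cut off at \<open>b\<close>:
      neighbouring points are closer than \<delta>, and \<open>b\<close> is reached after finitely
      many steps.\<close>
    define w where "w k = min b (a + real k * (\<delta> / 2))" for k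
    have w: "a \<le> w k" "w k \<le> w (Suc k)" "w (Suc k) \<le> b" "w (Suc k) - w k < \<delta>" for k
      using \<open>\<delta> > 0\<close> True unfolding w_def by (auto simp: min_def field_simps)
    have *: "f' absolutely_integrable_on {a..w k}" for k
    proof (induction k)
      case 0
      then show ?case using True \<delta>(1) short[of a a] by (simp add: w_def)
    next
      case (Suc k)
      have "f' absolutely_integrable_on {w k..w (Suc k)}"
        by (rule short) (use w[of k] in auto)
      then show ?case
        using Suc w by (blast intro: absolutely_integrable_on_combine)
    qed
    obtain k :: nat where "(b - a) / (\<delta> / 2) < real k"
      using reals_Archimedean2 by blast
    then have "w k = b" using \<delta>(1) by (simp add: w_def field_simps)
    then show ?thesis using *[of k] by simp
  qed auto
qed

section \<open>Pairs, products and change of variables\<close>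

lemma absolutely_continuous_on_Pair:
  assumes "absolutely_continuous_on S f" "absolutely_continuous_on S g"
  shows "absolutely_continuous_on S (\<lambda>t. (f t, g t))"
  unfolding absolutely_continuous_on_def
proof (intro allI impI)
  fix \<epsilon> :: real assume "\<epsilon> > 0"
  then have e2: "\<epsilon> / 2 > 0" by simp
  obtain \<delta>1 where \<delta>1: "\<delta>1 > 0" "\<And>\<D>. \<D> division_of \<Union>\<D> \<Longrightarrow> \<Union>\<D> \<subseteq> S \<Longrightarrow>
      (\<Sum>K\<in>\<D>. measure lborel K) < \<delta>1 \<Longrightarrow> (\<Sum>K\<in>\<D>. dist (f (Inf K)) (f (Sup K))) < \<epsilon> / 2"
    using assms(1) e2 unfolding absolutely_continuous_on_def by meson
  obtain \<delta>2 where \<delta>2: "\<delta>2 > 0" "\<And>\<D>. \<D> division_of \<Union>\<D> \<Longrightarrow> \<Union>\<D> \<subseteq> S \<Longrightarrow>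
      (\<Sum>K\<in>\<D>. measure lborel K) < \<delta>2 \<Longrightarrow> (\<Sum>K\<in>\<D>. dist (g (Inf K)) (g (Sup K))) < \<epsilon> / 2"
    using assms(2) e2 unfolding absolutely_continuous_on_def by meson
  have "(\<Sum>K\<in>\<D>. dist (f (Inf K), g (Inf K)) (f (Sup K), g (Sup K))) < \<epsilon>"
    if D: "\<D> division_of \<Union>\<D>" "\<Union>\<D> \<subseteq> S" "(\<Sum>K\<in>\<D>. measure lborel K) < min \<delta>1 \<delta>2" for \<D>
  proof -
    have "(\<Sum>K\<in>\<D>. dist (f (Inf K), g (Inf K)) (f (Sup K), g (Sup K)))
        \<le> (\<Sum>K\<in>\<D>. dist (f (Inf K)) (f (Sup K)) + dist (g (Inf K)) (g (Sup K)))"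
      by (rule sum_mono) (simp add: dist_Pair_Pair sqrt_sum_squares_le_sum)
    also have "\<dots> < \<epsilon>"
      using \<delta>1(2)[OF D(1,2)] \<delta>2(2)[OF D(1,2)] D(3) by (simp add: sum.distrib)
    finally show ?thesis .
  qed
  then show "\<exists>\<delta>>0. \<forall>\<D>. \<D> division_of \<Union>\<D> \<and> \<Union>\<D> \<subseteq> S \<and> (\<Sum>K\<in>\<D>. measure lborel K) < \<delta> \<longrightarrow>
      (\<Sum>K\<in>\<D>. dist (f (Inf K), g (Inf K)) (f (Sup K), g (Sup K))) < \<epsilon>"
    using \<delta>1(1) \<delta>2(1) by (intro exI[of _ "min \<delta>1 \<delta>2"]) auto
qed

text \<open>Both factors are bounded on the compact interval, and multiplication is Lipschitz on
  bounded sets.\<close>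

lemma absolutely_continuous_on_mult:
  fixes f g :: "real \<Rightarrow> real"
  assumes f: "absolutely_continuous_on {a..b} f" and g: "absolutely_continuous_on {a..b} g"
  shows "absolutely_continuous_on {a..b} (\<lambda>t. f t * g t)"
proof -
  have "bounded (f ` {a..b})" "bounded (g ` {a..b})"
    using assms by (auto intro!: compact_imp_bounded compact_continuous_image
        absolutely_continuous_on_imp_continuous_on)
  then obtain B C where B: "\<And>t. t \<in> {a..b} \<Longrightarrow> \<bar>f t\<bar> \<le> B" and C: "\<And>t. t \<in> {a..b} \<Longrightarrow> \<bar>g t\<bar> \<le> C"
    unfolding bounded_iff real_norm_def by (metis imageI)
  have "(\<bar>B\<bar> + \<bar>C\<bar>)-lipschitz_on ((\<lambda>t. (f t, g t)) ` {a..b}) (\<lambda>z. fst z * snd z)"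
  proof (rule lipschitz_onI, clarsimp)
    fix s t :: real assume st: "a \<le> s" "s \<le> b" "a \<le> t" "t \<le> b"
    have "\<bar>f s * g s - f t * g t\<bar> = \<bar>f s * (g s - g t) + (f s - f t) * g t\<bar>"
      by (simp add: algebra_simps)
    also have "\<dots> \<le> \<bar>B\<bar> * \<bar>g s - g t\<bar> + \<bar>f s - f t\<bar> * \<bar>C\<bar>"
      using B[of s] C[of t] st
      by (intro order_trans[OF abs_triangle_ineq] add_mono) (auto simp: abs_mult intro!: mult_mono)
    also have "\<dots> \<le> \<bar>B\<bar> * dist (f s, g s) (f t, g t) + dist (f s, g s) (f t, g t) * \<bar>C\<bar>"
      using dist_fst_le[of "(f s, g s)" "(f t, g t)"] dist_snd_le[of "(f s, g s)" "(f t, g t)"]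
      by (intro add_mono mult_left_mono mult_right_mono) (auto simp: dist_real_def)
    finally show "dist (f s * g s) (f t * g t) \<le> (\<bar>B\<bar> + \<bar>C\<bar>) * dist (f s, g s) (f t, g t)"
      by (simp add: dist_real_def algebra_simps)
  qed auto
  from absolutely_continuous_on_lipschitz_compose[OF absolutely_continuous_on_Pair[OF f g] this]
  show ?thesis by simp
qed

lemma absolutely_continuous_on_bounded_linear:
  assumes "absolutely_continuous_on S f" "bounded_linear G"
  shows "absolutely_continuous_on S (\<lambda>t. G (f t))"
proof -
  obtain B where "B-lipschitz_on UNIV G"
    using bounded_linear.lipschitz_boundE[OF assms(2)] by blast
  then show ?thesis
    using assms(1) by (blast intro: absolutely_continuous_on_lipschitz_compose lipschitz_on_subset)
qed

text \<open>Integration by parts, for the complementary area and for the exact form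
  \<open>p dy + \<mu> y dx\<close>.\<close>

lemma absolutely_continuous_on_mult_integral:
  fixes x y :: "real \<Rightarrow> real"
  assumes "s \<le> t" "absolutely_continuous_on {s..t} x" "absolutely_continuous_on {s..t} y" "negligible N"
    and "\<And>\<tau>. \<tau> \<in> {s..t} - N \<Longrightarrow> (x has_vector_derivative u \<tau>) (at \<tau>)"
    and "\<And>\<tau>. \<tau> \<in> {s..t} - N \<Longrightarrow> (y has_vector_derivative v \<tau>) (at \<tau>)"
  shows "((\<lambda>\<tau>. x \<tau> * v \<tau> + u \<tau> * y \<tau>) has_integral x t * y t - x s * y s) {s..t}"
  using assms
  by (intro fundamental_theorem_of_calculus_absolutely_continuous[where N=N and f="\<lambda>t. x t * y t"]
      absolutely_continuous_on_mult has_vector_derivative_mult)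
     (auto intro: has_vector_derivative_at_within)

text \<open>The primitive of \<open>k\<close> is Lipschitz because \<open>k\<close> is bounded on
  \<open>{c..d}\<close>. Its composition with \<open>x\<close> is therefore absolutely continuous,
  and the chain rule off \<open>N\<close> yields the integral.\<close>

lemma absolutely_continuous_on_substitution:
  fixes x k :: "real \<Rightarrow> real"
  assumes st: "s \<le> t" and ac: "absolutely_continuous_on {s..t} x" and N: "negligible N"
    and der: "\<And>\<tau>. \<tau> \<in> {s..t} - N \<Longrightarrow> (x has_vector_derivative u \<tau>) (at \<tau>)"
    and k: "continuous_on {c..d} k" and x: "x ` {s..t} \<subseteq> {c..d}"
  shows "((\<lambda>\<tau>. k (x \<tau>) * u \<tau>) has_integral integral {c..x t} k - integral {c..x s} k) {s..t}"
proof -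
  define K where "K z = integral {c..z} k" for z
  have derK: "(K has_real_derivative k z) (at z within {c..d})" if "z \<in> {c..d}" for z
    using integral_has_vector_derivative[OF k that]
    unfolding K_def has_real_derivative_iff_has_vector_derivative .
  have "bounded (k ` {c..d})"
    using k by (intro compact_imp_bounded compact_continuous_image) auto
  then obtain B where B: "\<And>z. z \<in> {c..d} \<Longrightarrow> \<bar>k z\<bar> \<le> B"
    unfolding bounded_iff real_norm_def by (metis imageI)
  have "c \<le> d" using x st by (auto simp: image_subset_iff)
  have "B-lipschitz_on {c..d} K"
  proof (rule lipschitz_onI)
    show "dist (K y) (K z) \<le> B * dist y z" if "y \<in> {c..d}" "z \<in> {c..d}" for y z
      unfolding dist_norm
      by (rule field_differentiable_bound[of "{c..d}" K k]) (use derK B that in auto)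
    show "B \<ge> 0" using B[of c] \<open>c \<le> d\<close> by auto
  qed
  then have "absolutely_continuous_on {s..t} (\<lambda>\<tau>. K (x \<tau>))"
    using absolutely_continuous_on_lipschitz_compose[OF ac] lipschitz_on_subset x by blast
  then have "((\<lambda>\<tau>. k (x \<tau>) * u \<tau>) has_integral K (x t) - K (x s)) {s..t}"
  proof (rule fundamental_theorem_of_calculus_absolutely_continuous[OF st _ N])
    fix \<tau> assume \<tau>: "\<tau> \<in> {s..t} - N"
    have "(K has_field_derivative k (x \<tau>)) (at (x \<tau>) within x ` {s..t})"
      by (rule DERIV_subset[OF derK x]) (use \<tau> x in blast)
    from field_vector_diff_chain_within[OF has_vector_derivative_at_within[OF der[OF \<tau>]] this]
    show "((\<lambda>\<tau>. K (x \<tau>)) has_vector_derivative k (x \<tau>) * u \<tau>) (at \<tau> within {s..t})"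
      by (simp add: o_def mult.commute)
  qed
  then show ?thesis by (simp add: K_def)
qed

section \<open>Integrals along a curve\<close>

text \<open>The integrand of \<open>curve_functional\<close> as a function of the velocity alone. At
  the origin division by zero gives the value 0.\<close>

definition newton_density :: "real \<Rightarrow> real \<Rightarrow> real" where
  "newton_density u v = (max v 0) ^ 3 / (u\<^sup>2 + v\<^sup>2)"

lemma newton_density_nonneg: "newton_density u v \<ge> 0"
  by (simp add: newton_density_def)

lemma newton_density_0 [simp]: "newton_density u 0 = 0"
  by (simp add: newton_density_def)

text \<open>Supplies an integrable majorant for the integrand.\<close>

lemma newton_density_le: "newton_density u v \<le> \<bar>v\<bar>"
proof (cases "v > 0")
  case True
  then have "v ^ 3 \<le> v * (u\<^sup>2 + v\<^sup>2)" by (simp add: power3_eq_cube power2_eq_square distrib_left)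
  then show ?thesis using True by (simp add: newton_density_def field_simps add_nonneg_pos)
qed (simp add: newton_density_def)

lemma newton_density_absolutely_integrable:
  assumes "u absolutely_integrable_on S" "v absolutely_integrable_on S" "S \<in> sets lebesgue"
  shows "(\<lambda>t. newton_density (u t) (v t)) absolutely_integrable_on S"
proof (rule measurable_bounded_by_integrable_imp_absolutely_integrable[OF _ assms(3)])
  have [measurable]: "u \<in> borel_measurable (lebesgue_on S)" "v \<in> borel_measurable (lebesgue_on S)"
    using assms by (auto dest: absolutely_integrable_measurable)
  show "(\<lambda>t. newton_density (u t) (v t)) \<in> borel_measurable (lebesgue_on S)"
    unfolding newton_density_def by measurable
  show "(\<lambda>t. \<bar>v t\<bar>) integrable_on S"
    using assms(2) by (simp add: absolutely_integrable_on_def)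
  show "norm (newton_density (u t) (v t)) \<le> \<bar>v t\<bar>" for t
    using newton_density_le newton_density_nonneg by simp
qed

text \<open>Passes from Lebesgue integrals of \<open>velocity\<close> to gauge integrals of any
  derivative known off a null set. Absolute integrability of the derivative makes the two kinds of
  integral agree.\<close>

lemma curve_integrals:
  fixes \<gamma> :: "real \<Rightarrow> real \<times> real"
  assumes ac: "absolutely_continuous_on {0..1} \<gamma>" and N: "negligible N"
    and der: "\<And>t. t \<in> {0..1} - N \<Longrightarrow> (\<gamma> has_vector_derivative (u t, v t)) (at t)"
  shows "((\<lambda>t. newton_density (u t) (v t)) has_integral curve_functional \<gamma>) {0..1}"
    and "((\<lambda>t. fst (\<gamma> t) * v t) has_integral (LINT t:{0..1}|lebesgue. fst (\<gamma> t) * snd (velocity \<gamma> t))) {0..1}"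
proof -
  have vel: "velocity \<gamma> t = (u t, v t)" if "t \<in> {0..1} - N" for t
    using der[OF that] by (rule vector_derivative_at)
  have "(\<lambda>t. (u t, v t)) absolutely_integrable_on {0..1}"
    by (rule absolutely_continuous_on_derivative_absolutely_integrable[OF ac N
          has_vector_derivative_at_within[OF der]])
  from absolutely_integrable_linear[OF this bounded_linear_fst]
       absolutely_integrable_linear[OF this bounded_linear_snd]
  have u: "u absolutely_integrable_on {0..1}" and v: "v absolutely_integrable_on {0..1}"
    by (simp_all add: o_def)
  have cont: "continuous_on {0..1} (\<lambda>t. fst (\<gamma> t))"
    by (intro continuous_on_fst absolutely_continuous_on_imp_continuous_on ac)
  have "(\<lambda>t. fst (\<gamma> t) * v t) absolutely_integrable_on {0..1}"
  proof (rule absolutely_integrable_bounded_measurable_product_real)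
    show "(\<lambda>t. fst (\<gamma> t)) \<in> borel_measurable (lebesgue_on {0..1})"
      using cont by (rule continuous_imp_measurable_on_sets_lebesgue) auto
    show "bounded ((\<lambda>t. fst (\<gamma> t)) ` {0..1})"
      by (intro compact_imp_bounded compact_continuous_image cont) auto
  qed (use v in auto)
  then have xv: "(\<lambda>t. fst (\<gamma> t) * snd (velocity \<gamma> t)) absolutely_integrable_on {0..1}"
    by (rule absolutely_integrable_spike[OF _ N]) (simp add: vel)
  have "(\<lambda>t. newton_density (u t) (v t)) absolutely_integrable_on {0..1}"
    using u v by (rule newton_density_absolutely_integrable) auto
  then have dens: "(\<lambda>t. newton_density (fst (velocity \<gamma> t)) (snd (velocity \<gamma> t))) absolutely_integrable_on {0..1}"
    by (rule absolutely_integrable_spike[OF _ N]) (simp add: vel)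
  show "((\<lambda>t. newton_density (u t) (v t)) has_integral curve_functional \<gamma>) {0..1}"
    using has_integral_set_lebesgue[OF dens]
    unfolding curve_functional_def newton_density_def[symmetric]
    by (rule has_integral_spike[OF N, rotated]) (simp add: vel)
  show "((\<lambda>t. fst (\<gamma> t) * v t) has_integral (LINT t:{0..1}|lebesgue. fst (\<gamma> t) * snd (velocity \<gamma> t))) {0..1}"
    using has_integral_set_lebesgue[OF xv]
    by (rule has_integral_spike[OF N, rotated]) (simp add: vel)
qed

text \<open>Collects all almost everywhere conditions in one exceptional set.\<close>

lemma admissible_derivative:
  assumes "\<gamma> \<in> admissible_curves a h L"
  obtains N u v where "negligible N" "\<And>t. u t \<ge> 0"
    "\<And>t. t \<in> {0..1} - N \<Longrightarrow> t \<in> {0<..<1} \<and> (\<gamma> has_vector_derivative (u t, v t)) (at t) \<and> (u t, v t) \<noteq> 0"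
proof -
  have "AE t in lebesgue. t \<in> {0<..<1} \<longrightarrow>
      \<gamma> differentiable (at t) \<and> velocity \<gamma> t \<noteq> 0 \<and> fst (velocity \<gamma> t) \<ge> 0"
    using assms unfolding admissible_curves_def by auto
  then obtain M where M: "M \<in> null_sets lebesgue" "{t. \<not> (t \<in> {0<..<1} \<longrightarrow>
      \<gamma> differentiable (at t) \<and> velocity \<gamma> t \<noteq> 0 \<and> fst (velocity \<gamma> t) \<ge> 0)} \<subseteq> M"
    unfolding eventually_ae_filter by auto
  \<comment> \<open>The endpoints are added because the almost everywhere conditions concern the
    open interval only.\<close>
  define N where "N = M \<union> {0, 1}"
  \<comment> \<open>The value 0 off the good set makes \<open>u\<close> nonnegative at every
    \<open>t\<close>.\<close>
  define u where "u t = (if t \<in> {0..1} - N then fst (velocity \<gamma> t) else 0)" for t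
  define v where "v t = snd (velocity \<gamma> t)" for t
  show thesis
  proof (rule that[of N u v])
    show "negligible N" using M by (simp add: N_def negligible_iff_null_sets)
    show "u t \<ge> 0" for t
    proof (cases "t \<in> {0..1} - N")
      case True
      then have "t \<in> {0<..<1}" "t \<notin> M" by (auto simp: N_def)
      then show ?thesis using M(2) True by (auto simp: u_def)
    qed (auto simp: u_def)
    show "t \<in> {0<..<1} \<and> (\<gamma> has_vector_derivative (u t, v t)) (at t) \<and> (u t, v t) \<noteq> 0"
      if t: "t \<in> {0..1} - N" for t
    proof -
      have "t \<in> {0<..<1}" using t by (auto simp: N_def)
      moreover then have "\<gamma> differentiable (at t)" "velocity \<gamma> t \<noteq> 0"
        using t M(2) unfolding N_def by blast+
      moreover have "(u t, v t) = velocity \<gamma> t"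
        using t by (simp add: u_def v_def)
      ultimately show ?thesis by (simp add: vector_derivative_works)
    qed
  qed
qed

lemma
  assumes "(\<gamma> has_vector_derivative (u, v)) F"
  shows has_vector_derivative_fst: "((\<lambda>t. fst (\<gamma> t)) has_vector_derivative u) F"
    and has_vector_derivative_snd: "((\<lambda>t. snd (\<gamma> t)) has_vector_derivative v) F"
  using bounded_linear.has_vector_derivative[OF bounded_linear_fst assms]
        bounded_linear.has_vector_derivative[OF bounded_linear_snd assms] by simp_all

text \<open>The integrals of \<open>x dy\<close> and \<open>y dx\<close> add up to
  \<open>a * h\<close>, so under the area constraint \<open>L\<close> is the integral of
  \<open>y dx\<close>.\<close>

lemma curve_area:
  fixes \<gamma> :: "real \<Rightarrow> real \<times> real"
  assumes ac: "absolutely_continuous_on {0..1} \<gamma>" and N: "negligible N"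
    and der: "\<And>t. t \<in> {0..1} - N \<Longrightarrow> (\<gamma> has_vector_derivative (u t, v t)) (at t)"
    and ends: "\<gamma> 0 = (0, 0)" "\<gamma> 1 = (a, h)"
  shows "((\<lambda>t. u t * snd (\<gamma> t)) has_integral
      a * h - (LINT t:{0..1}|lebesgue. fst (\<gamma> t) * snd (velocity \<gamma> t))) {0..1}"
proof -
  have "((\<lambda>t. fst (\<gamma> t) * v t + u t * snd (\<gamma> t)) has_integral a * h - 0 * 0) {0..1}"
    using absolutely_continuous_on_mult_integral[OF _
        absolutely_continuous_on_bounded_linear[OF ac bounded_linear_fst]
        absolutely_continuous_on_bounded_linear[OF ac bounded_linear_snd] N
        has_vector_derivative_fst[OF der] has_vector_derivative_snd[OF der]] ends
    by simp
  from has_integral_diff[OF this curve_integrals(2)[OF ac N der]]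
  show ?thesis by simp
qed

section \<open>The dual lower bound\<close>

text \<open>The inverse on slopes in \<open>{0..1}\<close> of the derivative of
  \<open>s^3 / (1 + s^2)\<close>. With \<open>w = s^2\<close> the equation is the quadratic
  \<open>w^2 + 3 w = p (1 + w)^2\<close> of discriminant \<open>9 - 8 p\<close>. This form of its
  root avoids the factor \<open>1 - p\<close> in the denominator, which would vanish at
  \<open>p = 1\<close>.\<close>

definition slope :: "real \<Rightarrow> real" where
  "slope p = sqrt ((3 - sqrt (9 - 8 * p)) / (1 + sqrt (9 - 8 * p)))"

text \<open>For \<open>p\<close> in \<open>{0..1}\<close> this is the convex conjugate of
  \<open>newton_density 1\<close>, the supremum being attained at \<open>slope p\<close>.\<close>

definition density_conj :: "real \<Rightarrow> real" where
  "density_conj p = p * slope p - newton_density 1 (slope p)"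

lemma slope_0 [simp]: "slope 0 = 0"
  by (simp add: slope_def real_sqrt_eq_iff)

lemma slope_1 [simp]: "slope 1 = 1"
  by (simp add: slope_def)

lemma continuous_on_slope: "continuous_on {..1} slope"
proof -
  have "1 + sqrt (9 - 8 * p) \<noteq> 0" if "p \<le> 1" for p :: real
    using that real_sqrt_ge_zero[of "9 - 8 * p"] by linarith
  then show ?thesis
    unfolding slope_def by (intro continuous_intros) auto
qed

lemma slope_mono:
  assumes "p \<le> p'" "p' \<le> 1"
  shows "slope p \<le> slope p'"
  unfolding slope_def
proof (rule real_sqrt_le_mono)
  define r r' where "r = sqrt (9 - 8 * p)" and "r' = sqrt (9 - 8 * p')"
  have "0 \<le> r'" "r' \<le> r" using assms by (auto simp: r_def r'_def)
  \<comment> \<open>In this form the fraction is visibly decreasing in the root, which itself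
    decreases in \<open>p\<close>.\<close>
  moreover have "(3 - x) / (1 + x) = 4 / (1 + x) - 1" if "x \<ge> 0" for x :: real
    using that by (simp add: field_simps)
  ultimately show "(3 - r) / (1 + r) \<le> (3 - r') / (1 + r')"
    by (simp add: frac_le)
qed

lemma slope_bounds: "p \<in> {0..1} \<Longrightarrow> slope p \<in> {0..1}"
  using slope_mono[of 0 p] slope_mono[of p 1] by auto

lemma newton_density_1: "s \<ge> 0 \<Longrightarrow> newton_density 1 s = s ^ 3 / (1 + s\<^sup>2)"
  by (simp add: newton_density_def)

text \<open>\<open>p\<close> is the derivative at \<open>slope p\<close> of \<open>s \<mapsto> s^3 / (1 + s^2)\<close>.\<close>

lemma slope_eq:
  assumes "p \<in> {0..1}"
  shows "slope p ^ 4 + 3 * (slope p)\<^sup>2 = p * (1 + (slope p)\<^sup>2)\<^sup>2"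
proof -
  define r w where "r = sqrt (9 - 8 * p)" and "w = (3 - r) / (1 + r)"
  have r: "r \<ge> 0" "r \<le> 3" "r\<^sup>2 = 9 - 8 * p"
    using assms real_sqrt_le_mono[of "9 - 8 * p" 9] by (auto simp: r_def)
  have s2: "(slope p)\<^sup>2 = w"
    using r by (simp add: slope_def r_def w_def)
  have "slope p ^ 4 = w\<^sup>2"
    using s2 by (metis power_even_eq mult_2 numeral_Bit0)
  moreover have w1: "1 + w = 4 / (1 + r)" using r by (simp add: w_def field_simps)
  moreover have "w\<^sup>2 + 3 * w = p * (1 + w)\<^sup>2"
  proof -
    have "w * (1 + r) = 3 - r" using r by (simp add: w_def)
    moreover have "p = (9 - r\<^sup>2) / 8" using r by simp
    ultimately have "(w\<^sup>2 + 3 * w) * (1 + r)\<^sup>2 = p * (1 + w)\<^sup>2 * (1 + r)\<^sup>2" by algebra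
    then show ?thesis using r by simp
  qed
  ultimately show ?thesis using s2 by simp
qed

text \<open>Eliminating \<open>p\<close> by \<open>slope_eq\<close> leaves a rational function of
  the slope, from which sign and continuity can be read off.\<close>

lemma density_conj_eq:
  assumes "p \<in> {0..1}"
  shows "density_conj p = 2 * slope p ^ 3 / (1 + (slope p)\<^sup>2)\<^sup>2"
proof -
  let ?s = "slope p"
  have pos: "1 + ?s\<^sup>2 > 0" by (simp add: add_pos_nonneg)
  have "p = (?s ^ 4 + 3 * ?s\<^sup>2) / (1 + ?s\<^sup>2)\<^sup>2"
    using slope_eq[OF assms] pos by (simp add: field_simps)
  then have "density_conj p = (?s ^ 4 + 3 * ?s\<^sup>2) / (1 + ?s\<^sup>2)\<^sup>2 * ?s - ?s ^ 3 / (1 + ?s\<^sup>2)"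
    using slope_bounds[OF assms] by (simp add: density_conj_def newton_density_1)
  also have "\<dots> = ((?s ^ 4 + 3 * ?s\<^sup>2) * ?s - ?s ^ 3 * (1 + ?s\<^sup>2)) / (1 + ?s\<^sup>2)\<^sup>2"
    using pos by (simp add: diff_divide_distrib power2_eq_square)
  also have "(?s ^ 4 + 3 * ?s\<^sup>2) * ?s - ?s ^ 3 * (1 + ?s\<^sup>2) = 2 * ?s ^ 3" by algebra
  finally show ?thesis .
qed

lemma density_conj_0 [simp]: "density_conj 0 = 0"
  by (simp add: density_conj_def)

lemma density_conj_1 [simp]: "density_conj 1 = 1 / 2"
  by (simp add: density_conj_def newton_density_1)

lemma density_conj_bounds:
  assumes "p \<in> {0..1}"
  shows "density_conj p \<in> {0..1}"
proof -
  have s: "0 \<le> slope p" "slope p \<le> 1" using slope_bounds[OF assms] by auto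
  have "density_conj p \<le> p * slope p"
    using newton_density_nonneg by (simp add: density_conj_def)
  also have "\<dots> \<le> 1" using s assms by (simp add: mult_le_one)
  finally show ?thesis using s by (simp add: density_conj_eq[OF assms])
qed

lemma continuous_on_density_conj: "continuous_on {0..1} density_conj"
proof -
  have "continuous_on {0..1} slope"
    using continuous_on_slope by (rule continuous_on_subset) auto
  moreover have "1 + (slope p)\<^sup>2 \<noteq> 0" for p by (simp add: add_nonneg_eq_0_iff)
  ultimately have "continuous_on {0..1} (\<lambda>p. 2 * slope p ^ 3 / (1 + (slope p)\<^sup>2)\<^sup>2)"
    by (intro continuous_intros) auto
  then show ?thesis by (rule continuous_on_eq) (simp add: density_conj_eq)
qed

text \<open>The tangent plane inequality. For \<open>v > 0\<close>, clearing denominators turns the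
  gap into a square, vanishing along the ray of slope \<open>slope p\<close>, times a factor that is
  nonnegative because \<open>slope p \<le> 1\<close>. For \<open>v \<le> 0\<close> the left side is
  nonpositive.\<close>

lemma newton_density_ge:
  assumes p: "p \<in> {0..1}" and u: "u \<ge> 0"
  shows "p * v - density_conj p * u \<le> newton_density u v"
proof (cases "v > 0")
  case False
  then have "p * v \<le> 0" "density_conj p * u \<ge> 0"
    using p u density_conj_bounds[OF p] by (auto simp: mult_le_0_iff)
  then show ?thesis using newton_density_nonneg[of u v] by linarith
next
  case True
  define s M where "s = slope p" and "M = (1 + s\<^sup>2)\<^sup>2"
  have s: "0 \<le> s" "s \<le> 1" using slope_bounds[OF p] by (auto simp: s_def)
  then have "s\<^sup>2 \<le> 1" by (simp add: power_le_one)
  have "1 + s\<^sup>2 > 0" by (simp add: add_pos_nonneg)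
  then have M: "M > 0" by (simp add: M_def)
  have pM: "p * M = s ^ 4 + 3 * s\<^sup>2" using slope_eq[OF p] by (simp add: s_def M_def)
  have cM: "density_conj p * M = 2 * s ^ 3"
    using density_conj_eq[OF p] M by (simp add: s_def M_def)
  have "M * (v ^ 3 - (p * v - density_conj p * u) * (u\<^sup>2 + v\<^sup>2))
      = M * v ^ 3 - ((p * M) * v - (density_conj p * M) * u) * (u\<^sup>2 + v\<^sup>2)" by algebra
  also have "\<dots> = (v - s * u)\<^sup>2 * ((1 - s\<^sup>2) * v + 2 * s * u)"
    unfolding pM cM unfolding M_def by algebra
  also have "\<dots> \<ge> 0" using s \<open>s\<^sup>2 \<le> 1\<close> True u by simp
  finally have "(p * v - density_conj p * u) * (u\<^sup>2 + v\<^sup>2) \<le> v ^ 3"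
    using M by (simp add: zero_le_mult_iff)
  moreover have "u\<^sup>2 + v\<^sup>2 > 0" using True by (simp add: add_nonneg_pos)
  ultimately show ?thesis using True by (simp add: newton_density_def pos_le_divide_eq)
qed

section \<open>Weak duality for admissible curves\<close>

definition pressure :: "real \<Rightarrow> real \<Rightarrow> real \<Rightarrow> real \<Rightarrow> real" where
  "pressure a \<mu> q x = max 0 (q - \<mu> * (a - x))"

text \<open>The part of the dual objective free of \<open>L\<close>. With the term
  \<open>\<mu> * L\<close> kept outside, one choice of \<open>\<mu>\<close> and \<open>q\<close>
  gives a bound affine in \<open>L\<close>.\<close>

definition dual_value :: "real \<Rightarrow> real \<Rightarrow> real \<Rightarrow> real \<Rightarrow> real" where
  "dual_value a h \<mu> q = q * h - integral {0..a} (\<lambda>x. density_conj (pressure a \<mu> q x))"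

lemma pressure_bounds:
  assumes "\<mu> \<ge> 0" "q \<in> {0..1}" "x \<le> a"
  shows "pressure a \<mu> q x \<in> {0..1}"
proof -
  have "\<mu> * (a - x) \<ge> 0" using assms by simp
  then show ?thesis using assms(2) unfolding pressure_def atLeastAtMost_iff by linarith
qed

lemma continuous_on_pressure: "continuous_on S (pressure a \<mu> q)"
  unfolding pressure_def by (intro continuous_intros)

lemma continuous_on_density_conj_pressure:
  assumes "\<mu> \<ge> 0" "q \<in> {0..1}"
  shows "continuous_on {0..a} (\<lambda>x. density_conj (pressure a \<mu> q x))"
  by (rule continuous_on_compose2[OF continuous_on_density_conj continuous_on_pressure])
     (use pressure_bounds[OF assms] in auto)

text \<open>
  After the time \<open>t0\<close> at which the pressure \<open>p\<close> becomes positive, \<open>p v + \<mu> y u\<close> is the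
  derivative of \<open>p y\<close> along the curve; before \<open>t0\<close> the integrand is merely bounded below by \<open>0\<close>.
\<close>

lemma dual_value_le_curve_functional:
  assumes a: "a > 0" and \<mu>: "\<mu> \<ge> 0" and q: "q \<in> {0..1}" and adm: "\<gamma> \<in> admissible_curves a h L"
  shows "dual_value a h \<mu> q - \<mu> * L \<le> curve_functional \<gamma>"
proof -
  obtain N u v where N: "negligible N" and u: "\<And>t. u t \<ge> 0"
    and der': "\<And>t. t \<in> {0..1} - N \<Longrightarrow>
      t \<in> {0<..<1} \<and> (\<gamma> has_vector_derivative (u t, v t)) (at t) \<and> (u t, v t) \<noteq> 0"
    by (rule admissible_derivative[OF adm]) blast
  have der: "\<And>t. t \<in> {0..1} - N \<Longrightarrow> (\<gamma> has_vector_derivative (u t, v t)) (at t)"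
    using der' by blast
  define x y where "x t = fst (\<gamma> t)" and "y t = snd (\<gamma> t)" for t
  have ac: "absolutely_continuous_on {0..1} \<gamma>"
    and img: "\<And>t. t \<in> {0..1} \<Longrightarrow> \<gamma> t \<in> {0..a} \<times> {0..h}"
    and ends: "\<gamma> 0 = (0, 0)" "\<gamma> 1 = (a, h)"
    and area: "(LINT t:{0..1}|lebesgue. fst (\<gamma> t) * snd (velocity \<gamma> t)) = a * h - L"
    using adm by (auto simp: admissible_curves_def pathstart_def pathfinish_def path_image_def)
  have acx: "absolutely_continuous_on {0..1} x" and acy: "absolutely_continuous_on {0..1} y"
    unfolding x_def y_def
    by (intro absolutely_continuous_on_bounded_linear[OF ac] bounded_linear_fst bounded_linear_snd)+
  have derx: "(x has_vector_derivative u t) (at t)" and dery: "(y has_vector_derivative v t) (at t)"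
    if "t \<in> {0..1} - N" for t
    unfolding x_def[abs_def] y_def[abs_def]
    by (rule has_vector_derivative_fst has_vector_derivative_snd, rule der[OF that])+
  have xy: "x t \<in> {0..a}" "y t \<in> {0..h}" if "t \<in> {0..1}" for t
    using img[OF that] by (auto simp: x_def y_def mem_Times_iff)
  have xy01: "x 0 = 0" "y 0 = 0" "x 1 = a" "y 1 = h"
    using ends by (auto simp: x_def y_def)
  have x_mono: "x s \<le> x t" if "0 \<le> s" "s \<le> t" "t \<le> 1" for s t
  proof -
    have "(u has_integral x t - x s) {s..t}"
      by (rule fundamental_theorem_of_calculus_absolutely_continuous[OF that(2)
            absolutely_continuous_on_subset[OF acx] N has_vector_derivative_at_within[OF derx]])
         (use that in auto)
    from has_integral_nonneg[OF this u] show ?thesis by simp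
  qed
  \<comment> \<open>The pressure along the curve before truncation at 0; it is nondecreasing since
    \<open>x\<close> is.\<close>
  define Q where "Q t = q - \<mu> * (a - x t)" for t
  have Q_mono: "Q s \<le> Q t" if "0 \<le> s" "s \<le> t" "t \<le> 1" for s t
    using x_mono[OF that] \<mu> by (simp add: Q_def mult_left_mono)
  have Q_cont: "continuous_on {0..1} Q"
    unfolding Q_def using absolutely_continuous_on_imp_continuous_on[OF acx]
    by (intro continuous_intros)
  have Q1: "Q 1 = q" by (simp add: Q_def xy01)
  define H where "H z = density_conj (pressure a \<mu> q z)" for z
  have H_cont: "continuous_on {0..a} H"
    unfolding H_def by (rule continuous_on_density_conj_pressure[OF \<mu> q])
  \<comment> \<open>Either \<open>Q\<close> is nonnegative from the start, where
    \<open>y = 0\<close>, or \<open>t0\<close> is a zero of \<open>Q\<close>. In both cases the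
    boundary term vanishes, and so does the integral of the conjugate up to
    \<open>x t0\<close>.\<close>
  obtain t0 where t0: "t0 \<in> {0..1}" "0 \<le> Q t0" "Q t0 * y t0 = 0" "integral {0..x t0} H = 0"
  proof (cases "Q 0 \<ge> 0")
    case True
    then show thesis by (intro that[of 0]) (auto simp: xy01)
  next
    case False
    then obtain t where t: "t \<in> {0..1}" "Q t = 0"
      using IVT'[of Q 0 0 1] Q1 q Q_cont by auto
    have "integral {0..x t} H = integral {0..x t} (\<lambda>_. 0)"
    proof (rule Henstock_Kurzweil_Integration.integral_cong)
      fix z assume "z \<in> {0..x t}"
      then have "q - \<mu> * (a - z) \<le> Q t"
        using \<mu> by (simp add: Q_def mult_left_mono)
      then show "H z = 0" using t by (simp add: H_def pressure_def max_def)
    qed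
    then show thesis using t by (intro that[of t]) auto
  qed
  have P_eq: "pressure a \<mu> q (x t) = Q t" "Q t \<in> {0..1}" if "t \<in> {t0..1}" for t
  proof -
    have "0 \<le> Q t" using Q_mono[of t0 t] t0 that by auto
    then show "pressure a \<mu> q (x t) = Q t" by (simp add: pressure_def Q_def)
    then show "Q t \<in> {0..1}"
      using pressure_bounds[OF \<mu> q, of "x t" a] xy(1)[of t] that t0 by auto
  qed
  have sub: "{t0..1} \<subseteq> {0..1}" using t0 by auto
  have "((\<lambda>t. Q t * v t + (\<mu> * u t) * y t) has_integral Q 1 * y 1 - Q t0 * y t0) {t0..1}"
  proof (rule absolutely_continuous_on_mult_integral[OF _ _ _ N])
    show "t0 \<le> 1" using t0 by simp
    have Q_eq: "Q = (\<lambda>t. (q - \<mu> * a) + \<mu> * x t)" by (auto simp: Q_def algebra_simps)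
    have "\<bar>\<mu>\<bar>-lipschitz_on (x ` {0..1}) (\<lambda>z. (q - \<mu> * a) + \<mu> * z)"
      by (rule lipschitz_onI) (auto simp: dist_real_def right_diff_distrib[symmetric] abs_mult simp del: right_diff_distrib)
    from absolutely_continuous_on_lipschitz_compose[OF acx this]
    show "absolutely_continuous_on {t0..1} Q"
      unfolding Q_eq by (rule absolutely_continuous_on_subset[OF _ sub])
    show "absolutely_continuous_on {t0..1} y"
      by (rule absolutely_continuous_on_subset[OF acy sub])
    show "(Q has_vector_derivative \<mu> * u \<tau>) (at \<tau>)" if "\<tau> \<in> {t0..1} - N" for \<tau>
    proof -
      have "(x has_real_derivative u \<tau>) (at \<tau>)"
        using derx[of \<tau>] that sub by (auto simp: has_real_derivative_iff_has_vector_derivative)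
      then have "(Q has_real_derivative \<mu> * u \<tau>) (at \<tau>)"
        unfolding Q_eq by (auto intro!: derivative_eq_intros)
      then show ?thesis by (simp add: has_real_derivative_iff_has_vector_derivative)
    qed
    show "(y has_vector_derivative v \<tau>) (at \<tau>)" if "\<tau> \<in> {t0..1} - N" for \<tau>
      using dery[of \<tau>] that sub by auto
  qed
  moreover have "((\<lambda>t. H (x t) * u t) has_integral integral {0..x 1} H - integral {0..x t0} H) {t0..1}"
  proof (rule absolutely_continuous_on_substitution[OF _ absolutely_continuous_on_subset[OF acx sub] N _ H_cont])
    show "(x has_vector_derivative u \<tau>) (at \<tau>)" if "\<tau> \<in> {t0..1} - N" for \<tau>
      using derx[of \<tau>] that sub by auto
    show "x ` {t0..1} \<subseteq> {0..a}" using xy(1) sub by blast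
  qed (use t0 in auto)
  ultimately have "((\<lambda>t. Q t * v t + (\<mu> * u t) * y t - H (x t) * u t) has_integral
      Q 1 * y 1 - Q t0 * y t0 - (integral {0..x 1} H - integral {0..x t0} H)) {t0..1}"
    by (rule has_integral_diff)
  moreover have "Q 1 * y 1 - Q t0 * y t0 - (integral {0..x 1} H - integral {0..x t0} H) = dual_value a h \<mu> q"
    unfolding t0(3,4) xy01 Q1 by (simp add: dual_value_def H_def[abs_def])
  ultimately have lower: "((\<lambda>t. Q t * v t + (\<mu> * u t) * y t - H (x t) * u t) has_integral dual_value a h \<mu> q) {t0..1}"
    by (simp only:)
  have total: "((\<lambda>t. newton_density (u t) (v t) + \<mu> * (u t * y t)) has_integral curve_functional \<gamma> + \<mu> * L) {0..1}"
  proof (rule has_integral_add[OF curve_integrals(1)[OF ac N der] has_integral_mult_right])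
    show "((\<lambda>t. u t * y t) has_integral L) {0..1}"
      using curve_area[OF ac N der ends] unfolding area y_def[abs_def] by simp
  qed
  then have "(\<lambda>t. newton_density (u t) (v t) + \<mu> * (u t * y t)) integrable_on {t0..1}"
    by (rule integrable_on_subinterval[OF has_integral_integrable sub])
  then obtain c where c: "((\<lambda>t. newton_density (u t) (v t) + \<mu> * (u t * y t)) has_integral c) {t0..1}"
    by (auto simp: integrable_on_def)
  have pos: "newton_density (u t) (v t) + \<mu> * (u t * y t) \<ge> 0" if "t \<in> {0..1}" for t
    using newton_density_nonneg \<mu> u xy(2)[OF that] by (auto intro!: add_nonneg_nonneg mult_nonneg_nonneg)
  have "c \<le> curve_functional \<gamma> + \<mu> * L"
    by (rule has_integral_subset_le[OF sub c total]) (use pos in blast)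
  moreover have "dual_value a h \<mu> q \<le> c"
  proof (rule has_integral_le[OF lower c])
    fix t assume t: "t \<in> {t0..1}"
    have "Q t * v t - H (x t) * u t \<le> newton_density (u t) (v t)"
      using newton_density_ge[OF P_eq(2)[OF t] u] P_eq(1)[OF t] by (simp add: H_def)
    then show "Q t * v t + (\<mu> * u t) * y t - H (x t) * u t \<le> newton_density (u t) (v t) + \<mu> * (u t * y t)"
      by (simp add: algebra_simps)
  qed
  ultimately show ?thesis by linarith
qed

section \<open>Curves composed of vertical segments and a graph\<close>

lemma admissible_curvesI:
  assumes ac: "absolutely_continuous_on {0..1} \<gamma>" and N: "negligible N"
    and der: "\<And>t. t \<in> {0..1} - N \<Longrightarrow> (\<gamma> has_vector_derivative (u t, v t)) (at t)"
    and uv: "\<And>t. t \<in> {0..1} - N \<Longrightarrow> u t \<ge> 0 \<and> (u t, v t) \<noteq> 0"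
    and img: "\<gamma> ` {0..1} \<subseteq> {0..a} \<times> {0..h}" and ends: "\<gamma> 0 = (0, 0)" "\<gamma> 1 = (a, h)"
    and simple: "simple_path \<gamma>"
    and area: "((\<lambda>t. fst (\<gamma> t) * v t) has_integral a * h - L) {0..1}"
  shows "\<gamma> \<in> admissible_curves a h L"
proof -
  have "AE t in lebesgue. t \<notin> N"
    using N by (auto simp: negligible_iff_null_sets intro: AE_not_in)
  then have ae: "AE t in lebesgue. t \<in> {0<..<1} \<longrightarrow>
      \<gamma> differentiable (at t) \<and> velocity \<gamma> t \<noteq> 0 \<and> fst (velocity \<gamma> t) \<ge> 0"
  proof (rule AE_mp, intro AE_I2 impI)
    fix t :: real assume "t \<notin> N" "t \<in> {0<..<1}"
    then have t: "t \<in> {0..1} - N" by auto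
    show "\<gamma> differentiable (at t) \<and> velocity \<gamma> t \<noteq> 0 \<and> fst (velocity \<gamma> t) \<ge> 0"
      using uv[OF t] der[OF t] vector_derivative_at[OF der[OF t]]
      by (auto intro: differentiableI_vector)
  qed
  have "(LINT t:{0..1}|lebesgue. fst (\<gamma> t) * snd (velocity \<gamma> t)) = a * h - L"
    using has_integral_unique[OF curve_integrals(2)[OF ac N der] area] .
  then show ?thesis
    using ac img ends simple ae
    by (auto simp: admissible_curves_def path_image_def pathstart_def pathfinish_def elim: AE_mp)
qed

lemma newton_density_scale: "c > 0 \<Longrightarrow> newton_density c (c * s) = c * newton_density 1 s"
proof -
  assume c: "c > 0"
  have "max (c * s) 0 = c * max s 0" using c by (simp add: max_mult_distrib_left)
  then have "newton_density c (c * s) = (c ^ 3 * max s 0 ^ 3) / (c\<^sup>2 * (1 + s\<^sup>2))"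
    by (simp add: newton_density_def power_mult_distrib distrib_left)
  also have "\<dots> = c * newton_density 1 s"
    using c by (simp add: newton_density_def power3_eq_cube power2_eq_square)
  finally show ?thesis .
qed

lemma newton_density_vertical: "c > 0 \<Longrightarrow> newton_density 0 c = c"
  by (simp add: newton_density_def power3_eq_cube power2_eq_square)

text \<open>
  The curve climbs vertically from \<open>(0, 0)\<close> to \<open>(0, b)\<close>, follows a graph with slope \<open>s\<close> up to the
  line \<open>x = a\<close> and climbs vertically to \<open>(a, h)\<close>. The parameter \<open>\<tau> = T t\<close> is \<open>x\<close> plus the length
  of the vertical parts traversed so far, so that these have length \<open>\<tau> - x\<close>.
\<close>

lemma ex_admissible_graph_curve:
  fixes s :: "real \<Rightarrow> real"
  assumes a: "a > 0" and s_cont: "continuous_on {0..a} s" and s01: "\<And>z. z \<in> {0..a} \<Longrightarrow> s z \<in> {0..1}"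
    and b: "b \<ge> 0" and bh: "b + integral {0..a} s \<le> h"
  shows "\<exists>\<gamma>\<in>admissible_curves a h (a * b + integral {0..a} (\<lambda>z. (a - z) * s z)).
    curve_functional \<gamma> = h - integral {0..a} s + integral {0..a} (\<lambda>z. newton_density 1 (s z))"
proof -
  define Y where "Y z = integral {0..z} s" for z
  \<comment> \<open>The total parameter length: \<open>a\<close> for the graph and
    \<open>h - Y a\<close> for the two vertical parts together.\<close>
  define T where "T = a + (h - Y a)"
  \<comment> \<open>The clamping holds \<open>x\<close> at 0 during the first climb, of length
    \<open>b\<close>, and at \<open>a\<close> during the last one.\<close>
  define X where "X t = max 0 (min a (T * t - b))" for t
  define \<gamma> where "\<gamma> t = (X t, Y (X t) + T * t - X t)" for t
  \<comment> \<open>The two times at which the curve passes between graph and vertical part.\<close>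
  define N where "N = {b / T, (a + b) / T}"
  define u where "u t = (if b < T * t \<and> T * t < a + b then T else 0)" for t
  define v where "v t = u t * s (X t) + T - u t" for t
  have N: "negligible N" by (simp add: N_def)
  have hY: "b + Y a \<le> h" using bh by (simp add: Y_def)
  have T: "T \<ge> a" "T > 0" "T \<ge> a + b" using hY a b by (auto simp: T_def)
  have X01: "X t \<in> {0..a}" for t using a by (auto simp: X_def)
  have X0: "X 0 = 0" and X1: "X 1 = a" using a b T by (auto simp: X_def)
  have Y0: "Y 0 = 0" by (simp add: Y_def)
  have derY: "(Y has_real_derivative s z) (at z within {0..a})" if "z \<in> {0..a}" for z
    using integral_has_vector_derivative[OF s_cont that]
    unfolding Y_def[abs_def] has_real_derivative_iff_has_vector_derivative .
  have Y_cont: "continuous_on {0..a} Y"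
    using derY by (meson DERIV_continuous continuous_on_eq_continuous_within)
  have s_int: "s integrable_on {0..z}" if "z \<in> {0..a}" for z
    using that by (intro integrable_continuous_real continuous_on_subset[OF s_cont]) auto
  have Y_mono: "0 \<le> Y z" "Y z \<le> Y a" if "z \<in> {0..a}" for z
  proof -
    show "0 \<le> Y z"
      unfolding Y_def using that s01 by (intro integral_nonneg s_int) auto
    show "Y z \<le> Y a"
      unfolding Y_def using that s01 by (intro integral_subset_le s_int) auto
  qed
  have ac_comp: "absolutely_continuous_on {0..1} X" "absolutely_continuous_on {0..1} (\<lambda>t. Y (X t))"
    "absolutely_continuous_on {0..1} (\<lambda>t. T * t)"
  proof -
    have "T-lipschitz_on {0..1} X"
    proof (rule lipschitz_onI)
      fix r t :: real
      have "dist (X r) (X t) \<le> \<bar>T * r - T * t\<bar>" by (auto simp: X_def dist_real_def)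
      also have "\<dots> = T * dist r t"
        using T by (simp add: dist_real_def abs_mult flip: right_diff_distrib)
      finally show "dist (X r) (X t) \<le> T * dist r t" .
    qed (use T in auto)
    then show acX: "absolutely_continuous_on {0..1} X"
      by (rule lipschitz_imp_absolutely_continuous_on)
    have "1-lipschitz_on {0..a} Y"
    proof (rule lipschitz_onI)
      show "dist (Y y) (Y z) \<le> 1 * dist y z" if "y \<in> {0..a}" "z \<in> {0..a}" for y z
        unfolding dist_norm
        by (rule field_differentiable_bound[of "{0..a}" Y s]) (use derY s01 that in auto)
    qed auto
    then have "1-lipschitz_on (X ` {0..1}) Y"
      by (rule lipschitz_on_subset) (use X01 in auto)
    then show "absolutely_continuous_on {0..1} (\<lambda>t. Y (X t))"
      by (rule absolutely_continuous_on_lipschitz_compose[OF acX])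
    show "absolutely_continuous_on {0..1} (\<lambda>t. T * t)"
      by (rule absolutely_continuous_on_bounded_linear[OF absolutely_continuous_on_id bounded_linear_mult_right])
  qed
  have ac: "absolutely_continuous_on {0..1} \<gamma>"
  proof -
    have "bounded_linear (\<lambda>(x, y, z). (x, y + z - x) :: real \<times> real)"
      unfolding case_prod_unfold by (intro bounded_linear_intros)
    from absolutely_continuous_on_bounded_linear[OF absolutely_continuous_on_Pair[OF ac_comp(1)
        absolutely_continuous_on_Pair[OF ac_comp(2,3)]] this]
    show ?thesis by (simp add: \<gamma>_def[abs_def])
  qed
  have derX: "(X has_vector_derivative u t) (at t)" if "t \<in> {0..1} - N" for t
  proof -
    have ne: "T * t \<noteq> b" "T * t \<noteq> a + b"
      using that T by (auto simp: N_def eq_divide_eq mult.commute)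
    have op: "open {r. T * r < c}" "open {r. c < T * r}" for c
      by (auto intro!: open_Collect_less continuous_intros)
    consider "T * t < b" | "b < T * t" "T * t < a + b" | "a + b < T * t"
      using ne by linarith
    then show ?thesis
    proof cases
      case 1
      have "((\<lambda>r. 0) has_vector_derivative u t) (at t)"
        using 1 by (simp add: u_def)
      then show ?thesis
        by (rule has_vector_derivative_transform_within_open[OF _ op(1)[of b]])
           (use 1 in \<open>auto simp: X_def\<close>)
    next
      case 2
      have "((\<lambda>r. T * r - b) has_vector_derivative u t) (at t)"
        using 2 unfolding has_real_derivative_iff_has_vector_derivative[symmetric]
        by (auto intro!: derivative_eq_intros simp: u_def)
      then show ?thesis
        by (rule has_vector_derivative_transform_within_open[OF _ open_Int[OF op(1)[of "a + b"] op(2)[of b]]])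
           (use 2 in \<open>auto simp: X_def\<close>)
    next
      case 3
      have "((\<lambda>r. a) has_vector_derivative u t) (at t)"
        using 3 by (simp add: u_def)
      then show ?thesis
        by (rule has_vector_derivative_transform_within_open[OF _ op(2)[of "a + b"]])
           (use 3 a in \<open>auto simp: X_def\<close>)
    qed
  qed
  have der: "(\<gamma> has_vector_derivative (u t, v t)) (at t)" if t: "t \<in> {0..1} - N" for t
  proof -
    have "(Y has_field_derivative s (X t)) (at (X t) within range X)"
      by (rule DERIV_subset[OF derY]) (use X01 in auto)
    from field_vector_diff_chain_within[OF derX[OF t] this]
    have "((\<lambda>r. Y (X r)) has_vector_derivative u t * s (X t)) (at t)"
      by (simp add: o_def)
    moreover have "((\<lambda>r. T * r) has_vector_derivative T) (at t)"
      unfolding has_real_derivative_iff_has_vector_derivative[symmetric]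
      by (auto intro!: derivative_eq_intros)
    ultimately show ?thesis
      unfolding \<gamma>_def[abs_def] v_def using derX[OF t]
      by (intro has_vector_derivative_Pair has_vector_derivative_diff has_vector_derivative_add)
  qed
  have ends: "\<gamma> 0 = (0, 0)" "\<gamma> 1 = (a, h)"
    by (simp_all add: \<gamma>_def X0 X1 Y0 T_def)
  have sub: "((\<lambda>t. k (X t) * u t) has_integral integral {0..a} k) {0..1}"
    if "continuous_on {0..a} k" for k
    using absolutely_continuous_on_substitution[OF _ ac_comp(1) N derX that] X01
    by (simp add: X0 X1 image_subset_iff)
  \<comment> \<open>Integration by parts: \<open>(a - z) * Y z\<close> vanishes at both
    ends.\<close>
  have Y_int: "integral {0..a} Y = integral {0..a} (\<lambda>z. (a - z) * s z)"
  proof -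
    have "((\<lambda>z. (a - z) * s z - Y z) has_integral (a - a) * Y a - (a - 0) * Y 0) {0..a}"
    proof (rule fundamental_theorem_of_calculus)
      fix z assume "z \<in> {0..a}"
      then show "((\<lambda>z. (a - z) * Y z) has_vector_derivative (a - z) * s z - Y z) (at z within {0..a})"
        unfolding has_real_derivative_iff_has_vector_derivative[symmetric]
        by (auto intro!: derivative_eq_intros derY)
    qed (use a in auto)
    then have "integral {0..a} (\<lambda>z. (a - z) * s z - Y z) = 0"
      by (simp add: Y0 integral_unique)
    moreover have "(\<lambda>z. (a - z) * s z) integrable_on {0..a}" "Y integrable_on {0..a}"
      by (intro integrable_continuous_real continuous_intros s_cont Y_cont)+
    ultimately show ?thesis by (simp add: integral_diff)
  qed
  define L where "L = a * b + integral {0..a} (\<lambda>z. (a - z) * s z)"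
  have area': "((\<lambda>t. u t * snd (\<gamma> t)) has_integral L) {0..1}"
  proof -
    have "((\<lambda>t. (Y (X t) + b) * u t) has_integral integral {0..a} (\<lambda>z. Y z + b)) {0..1}"
      by (intro sub continuous_intros Y_cont)
    moreover have "integral {0..a} (\<lambda>z. Y z + b) = L"
      using Y_cont a Y_int by (subst integral_add) (auto simp: L_def integrable_continuous_real)
    \<comment> \<open>Where \<open>u\<close> is nonzero the curve is on its graph part, and there
      \<open>T * t - X t = b\<close>.\<close>
    moreover have "(Y (X t) + b) * u t = u t * snd (\<gamma> t)" for t
      by (auto simp: u_def \<gamma>_def X_def)
    ultimately show ?thesis by simp
  qed
  have area: "((\<lambda>t. fst (\<gamma> t) * v t) has_integral a * h - L) {0..1}"
  proof -
    have "(LINT t:{0..1}|lebesgue. fst (\<gamma> t) * snd (velocity \<gamma> t)) = a * h - L"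
      using has_integral_unique[OF curve_area[OF ac N der ends] area'] by linarith
    then show ?thesis using curve_integrals(2)[OF ac N der] by simp
  qed
  have "\<gamma> \<in> admissible_curves a h L"
  proof (rule admissible_curvesI[OF ac N der _ _ ends _ area])
    show "u t \<ge> 0 \<and> (u t, v t) \<noteq> 0" for t
      using T by (auto simp: u_def v_def zero_prod_def)
    show "\<gamma> ` {0..1} \<subseteq> {0..a} \<times> {0..h}"
    proof (rule image_subsetI)
      fix t :: real assume t: "t \<in> {0..1}"
      have Tt: "0 \<le> T * t" "T * t \<le> T" using t T by (auto simp: mult_left_le)
      have "X t \<le> T * t" "T * t - X t \<le> T - a"
        unfolding X_def using Tt T a b by linarith+
      then have "0 \<le> Y (X t) + T * t - X t" "Y (X t) + T * t - X t \<le> h"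
        using Y_mono[OF X01[of t]] by (auto simp: T_def)
      then show "\<gamma> t \<in> {0..a} \<times> {0..h}" using X01[of t] by (simp add: \<gamma>_def)
    qed
    \<comment> \<open>The first coordinate fixes \<open>X t\<close> and \<open>Y (X t)\<close>, and
      the second then determines \<open>T * t\<close>.\<close>
    have "inj_on \<gamma> {0..1}" using T by (auto simp: inj_on_def \<gamma>_def)
    then show "simple_path \<gamma>"
      using absolutely_continuous_on_imp_continuous_on[OF ac]
      by (intro arc_imp_simple_path) (simp add: arc_def path_def)
  qed auto
  moreover have "curve_functional \<gamma> = h - integral {0..a} s + integral {0..a} (\<lambda>z. newton_density 1 (s z))"
  proof -
    have k_cont: "continuous_on {0..a} (\<lambda>z. newton_density 1 (s z))"
    proof -
      have "1 + (s z)\<^sup>2 \<noteq> 0" for z by (simp add: add_nonneg_eq_0_iff)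
      then show ?thesis unfolding newton_density_def by (intro continuous_intros s_cont) auto
    qed
    \<comment> \<open>One expression for all pieces: it equals \<open>T\<close> on vertical parts,
      where \<open>u = 0\<close>, and \<open>T\<close> times the density of the graph where
      \<open>u = T\<close>.\<close>
    have "((\<lambda>t. (newton_density 1 (s (X t)) - 1) * u t + T) has_integral
        integral {0..a} (\<lambda>z. newton_density 1 (s z) - 1) + T) {0..1}"
      using has_integral_const_real[of T 0 1]
      by (intro has_integral_add sub continuous_intros k_cont) simp_all
    moreover have "(newton_density 1 (s (X t)) - 1) * u t + T = newton_density (u t) (v t)" for t
      using T by (auto simp: u_def v_def newton_density_scale newton_density_vertical algebra_simps)
    moreover have "integral {0..a} (\<lambda>z. newton_density 1 (s z) - 1) =
        integral {0..a} (\<lambda>z. newton_density 1 (s z)) - a"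
      using a k_cont by (subst integral_diff) (auto simp: integrable_continuous_real)
    ultimately have "((\<lambda>t. newton_density (u t) (v t)) has_integral
        integral {0..a} (\<lambda>z. newton_density 1 (s z)) - a + T) {0..1}" by simp
    from has_integral_unique[OF curve_integrals(1)[OF ac N der] this]
    show ?thesis by (simp add: T_def Y_def)
  qed
  ultimately show ?thesis unfolding L_def by blast
qed

section \<open>Central symmetry\<close>

text \<open>Reflection maps divisions of subsets of the unit interval to such divisions, keeping
  lengths and exchanging the roles of \<open>Inf\<close> and \<open>Sup\<close>.\<close>

lemma absolutely_continuous_on_reflect:
  fixes f :: "real \<Rightarrow> 'a::metric_space"
  assumes f: "absolutely_continuous_on {0..1} f"
  shows "absolutely_continuous_on {0..1} (\<lambda>t. f (1 - t))"
  unfolding absolutely_continuous_on_def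
proof (intro allI impI)
  fix \<epsilon> :: real assume "\<epsilon> > 0"
  then obtain \<delta> where \<delta>: "\<delta> > 0" "\<And>\<D>. \<D> division_of \<Union>\<D> \<Longrightarrow> \<Union>\<D> \<subseteq> {0..1} \<Longrightarrow>
      (\<Sum>K\<in>\<D>. measure lborel K) < \<delta> \<Longrightarrow> (\<Sum>K\<in>\<D>. dist (f (Inf K)) (f (Sup K))) < \<epsilon>"
    using f unfolding absolutely_continuous_on_def by meson
  have "(\<Sum>K\<in>\<D>. dist (f (1 - Inf K)) (f (1 - Sup K))) < \<epsilon>"
    if D: "\<D> division_of \<Union>\<D>" "\<Union>\<D> \<subseteq> {0..1}" "(\<Sum>K\<in>\<D>. measure lborel K) < \<delta>" for \<D>
  proof -
    define R where "R = image (\<lambda>t::real. 1 - t)"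
    have R: "R K = {1 - Sup K..1 - Inf K}" "K = {Inf K..Sup K}" "Inf K \<le> Sup K" "R K \<subseteq> {0..1}"
        "measure lborel (R K) = measure lborel K" if K: "K \<in> \<D>" for K
    proof -
      obtain u v where "u \<le> v" "K = {u..v}" "Inf K = u" "Sup K = v" "u \<in> \<Union>\<D>" "v \<in> \<Union>\<D>"
        by (rule division_of_real_elemE[OF D(1) K])
      moreover then have "u \<in> {0..1}" "v \<in> {0..1}" using D(2) by blast+
      ultimately show "R K = {1 - Sup K..1 - Inf K}" "K = {Inf K..Sup K}" "Inf K \<le> Sup K"
        "R K \<subseteq> {0..1}" "measure lborel (R K) = measure lborel K"
        by (simp_all add: R_def)
    qed
    have "inj (\<lambda>t::real. 1 - t)" by (simp add: inj_def)
    then have inj: "inj_on R \<D>"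
      unfolding R_def by (intro inj_onI) (simp add: inj_image_eq_iff)
    have sub: "\<Union>(R ` \<D>) \<subseteq> {0..1}" using R(4) by blast
    have div: "R ` \<D> division_of \<Union>(R ` \<D>)"
      unfolding division_of_def
    proof (intro conjI ballI impI)
      show "finite (R ` \<D>)" using D(1) by blast
      show "\<Union>(R ` \<D>) = \<Union>(R ` \<D>)" ..
      fix K1 assume "K1 \<in> R ` \<D>"
      then obtain K where K: "K1 = R K" "K \<in> \<D>" by blast
      show "K1 \<subseteq> \<Union>(R ` \<D>)" using \<open>K1 \<in> R ` \<D>\<close> by blast
      show "K1 \<noteq> {}" using R[OF K(2)] K(1) by simp
      show "\<exists>a b. K1 = cbox a b" using R(1)[OF K(2)] K(1) by auto
      fix K2 assume "K2 \<in> R ` \<D>" "K1 \<noteq> K2"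
      then obtain K' where K': "K2 = R K'" "K' \<in> \<D>" "K \<noteq> K'" using K by blast
      have "interior K \<inter> interior K' = {}"
        using division_ofD(5)[OF D(1)] K K' by blast
      then have dis: "{Inf K<..<Sup K} \<inter> {Inf K'<..<Sup K'} = {}"
        using R(2)[OF K(2)] R(2)[OF K'(2)] by (metis interior_atLeastAtMost_real)
      have "z \<notin> {1 - Sup K<..<1 - Inf K} \<inter> {1 - Sup K'<..<1 - Inf K'}" for z
      proof
        assume "z \<in> {1 - Sup K<..<1 - Inf K} \<inter> {1 - Sup K'<..<1 - Inf K'}"
        then have "1 - z \<in> {Inf K<..<Sup K} \<inter> {Inf K'<..<Sup K'}" by auto
        then show False using dis by blast
      qed
      then show "interior K1 \<inter> interior K2 = {}"
        unfolding K(1) K'(1) R(1)[OF K(2)] R(1)[OF K'(2)] interior_atLeastAtMost_real by blast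
    qed
    have "(\<Sum>K\<in>R ` \<D>. measure lborel K) = (\<Sum>K\<in>\<D>. measure lborel K)"
      by (subst sum.reindex[OF inj], rule sum.cong) (auto simp: R(5))
    with \<delta>(2)[OF div sub] D(3) have "(\<Sum>K\<in>R ` \<D>. dist (f (Inf K)) (f (Sup K))) < \<epsilon>"
      by simp
    moreover have "(\<Sum>K\<in>R ` \<D>. dist (f (Inf K)) (f (Sup K))) = (\<Sum>K\<in>\<D>. dist (f (1 - Inf K)) (f (1 - Sup K)))"
      by (subst sum.reindex[OF inj], rule sum.cong) (auto simp: R dist_commute)
    ultimately show ?thesis by simp
  qed
  with \<delta>(1) show "\<exists>\<delta>>0. \<forall>\<D>. \<D> division_of \<Union>\<D> \<and> \<Union>\<D> \<subseteq> {0..1} \<and> (\<Sum>K\<in>\<D>. measure lborel K) < \<delta> \<longrightarrow>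
      (\<Sum>K\<in>\<D>. dist (f (1 - Inf K)) (f (1 - Sup K))) < \<epsilon>"
    by blast
qed

lemma has_integral_reflect_unit_interval:
  fixes f :: "real \<Rightarrow> real"
  assumes "(f has_integral i) {0..1}"
  shows "((\<lambda>t. f (1 - t)) has_integral i) {0..1}"
  using has_integral_affinity[of f i 0 1 "-1" 1] assms
    image_affinity_cbox[of "-1" 1 0 "1::real"] by simp

text \<open>The curve is rotated by a half turn about the centre of the rectangle and run backwards.
  The two sign changes cancel in the velocity, so the functional is kept, while the areas on both
  sides of the curve are exchanged.\<close>

lemma admissible_curves_reflect:
  assumes adm: "\<gamma> \<in> admissible_curves a h L"
  defines "\<rho> \<equiv> \<lambda>t. (a, h) - \<gamma> (1 - t)"
  shows "\<rho> \<in> admissible_curves a h (a * h - L)" "curve_functional \<rho> = curve_functional \<gamma>"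
proof -
  obtain N u v where N: "negligible N" and u: "\<And>t. u t \<ge> 0"
    and der': "\<And>t. t \<in> {0..1} - N \<Longrightarrow>
      t \<in> {0<..<1} \<and> (\<gamma> has_vector_derivative (u t, v t)) (at t) \<and> (u t, v t) \<noteq> 0"
    by (rule admissible_derivative[OF adm]) blast
  have der: "\<And>t. t \<in> {0..1} - N \<Longrightarrow> (\<gamma> has_vector_derivative (u t, v t)) (at t)"
    using der' by blast
  have ac: "absolutely_continuous_on {0..1} \<gamma>"
    and img: "\<And>t. t \<in> {0..1} \<Longrightarrow> \<gamma> t \<in> {0..a} \<times> {0..h}"
    and ends: "\<gamma> 0 = (0, 0)" "\<gamma> 1 = (a, h)"
    and simple: "simple_path \<gamma>"
    and area: "(LINT t:{0..1}|lebesgue. fst (\<gamma> t) * snd (velocity \<gamma> t)) = a * h - L"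
    using adm by (auto simp: admissible_curves_def pathstart_def pathfinish_def path_image_def)
  define M where "M = (\<lambda>t. 1 - t) ` N"
  have M: "negligible M"
    unfolding M_def by (rule negligible_differentiable_image_negligible[OF _ N])
      (auto intro!: derivative_intros)
  have reflM: "1 - t \<in> {0..1} - N" if "t \<in> {0..1} - M" for t
    using that by (force simp: M_def image_iff)
  have "1-lipschitz_on ((\<lambda>t. \<gamma> (1 - t)) ` {0..1}) (\<lambda>z. (a, h) - z)"
    by (rule lipschitz_onI) (simp_all add: dist_norm norm_minus_commute)
  from absolutely_continuous_on_lipschitz_compose[OF absolutely_continuous_on_reflect[OF ac] this]
  have acR: "absolutely_continuous_on {0..1} \<rho>" by (simp add: \<rho>_def)
  have derR: "(\<rho> has_vector_derivative (u (1 - t), v (1 - t))) (at t)" if t: "t \<in> {0..1} - M" for t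
  proof -
    have "((\<lambda>t. 1 - t) has_vector_derivative - 1) (at t)"
      by (auto intro!: derivative_eq_intros)
    from vector_diff_chain_at[OF this der[OF reflM[OF t]]]
    have "((\<lambda>t. \<gamma> (1 - t)) has_vector_derivative - (u (1 - t), v (1 - t))) (at t)"
      by (simp add: o_def)
    from has_vector_derivative_diff[OF has_vector_derivative_const[of "(a, h)"] this]
    show ?thesis by (simp add: \<rho>_def)
  qed
  have "curve_functional \<gamma> = curve_functional \<rho>"
    using has_integral_unique[OF has_integral_reflect_unit_interval[OF curve_integrals(1)[OF ac N der]]
      curve_integrals(1)[OF acR M derR]] .
  then show "curve_functional \<rho> = curve_functional \<gamma>" by simp
  show "\<rho> \<in> admissible_curves a h (a * h - L)"
  proof (rule admissible_curvesI[OF acR M derR])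
    show "u (1 - t) \<ge> 0 \<and> (u (1 - t), v (1 - t)) \<noteq> 0" if "t \<in> {0..1} - M" for t
      using u der' reflM[OF that] by blast
    show "\<rho> ` {0..1} \<subseteq> {0..a} \<times> {0..h}"
    proof (rule image_subsetI)
      fix t :: real assume "t \<in> {0..1}"
      then show "\<rho> t \<in> {0..a} \<times> {0..h}"
        using img[of "1 - t"] by (auto simp: \<rho>_def mem_Times_iff)
    qed
    show "\<rho> 0 = (0, 0)" "\<rho> 1 = (a, h)" using ends by (simp_all add: \<rho>_def zero_prod_def)
    have "loop_free \<rho>"
      unfolding loop_free_def
    proof (intro ballI impI)
      fix r t :: real assume rt: "r \<in> {0..1}" "t \<in> {0..1}" "\<rho> r = \<rho> t"
      then have "\<gamma> (1 - r) = \<gamma> (1 - t)" "1 - r \<in> {0..1}" "1 - t \<in> {0..1}"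
        by (auto simp: \<rho>_def)
      then have "1 - r = 1 - t \<or> 1 - r = 0 \<and> 1 - t = 1 \<or> 1 - r = 1 \<and> 1 - t = 0"
        using simple unfolding simple_path_def loop_free_def by blast
      then show "r = t \<or> r = 0 \<and> t = 1 \<or> r = 1 \<and> t = 0" by auto
    qed
    then show "simple_path \<rho>"
      using absolutely_continuous_on_imp_continuous_on[OF acR] by (simp add: simple_path_def path_def)
    have "(v has_integral snd (\<gamma> 1) - snd (\<gamma> 0)) {0..1}"
      by (rule fundamental_theorem_of_calculus_absolutely_continuous[OF _
            absolutely_continuous_on_bounded_linear[OF ac bounded_linear_snd] N
            has_vector_derivative_at_within[OF has_vector_derivative_snd[OF der]]]) auto
    \<comment> \<open>The integral of \<open>(a - x) dy\<close> is \<open>a * h\<close> minus the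
      old constraint value, which is the constraint value required of the reflected curve.\<close>
    then have "((\<lambda>t. a * v t - fst (\<gamma> t) * v t) has_integral a * h - (a * h - L)) {0..1}"
      using curve_integrals(2)[OF ac N der] ends unfolding area
      by (intro has_integral_diff has_integral_mult_right) auto
    from has_integral_reflect_unit_interval[OF this]
    show "((\<lambda>t. fst (\<rho> t) * v (1 - t)) has_integral a * h - (a * h - L)) {0..1}"
      by (simp add: \<rho>_def left_diff_distrib)
  qed
qed

text \<open>Reflecting in both directions makes the two sets of values equal, hence also their
  \<open>LEAST\<close> terms.\<close>

lemma F_min_symmetric: "F_min a h (a * h - L) = F_min a h L"
proof -
  have sub: "curve_functional ` admissible_curves a h L \<subseteq> curve_functional ` admissible_curves a h (a * h - L)" for L
    using admissible_curves_reflect[of _ a h L] by (metis image_subsetI image_eqI)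
  have "curve_functional ` admissible_curves a h (a * h - L) = curve_functional ` admissible_curves a h L"
    using sub[of L] sub[of "a * h - L"] by auto
  then show ?thesis by (simp add: F_min_def)
qed

section \<open>Choice of the multiplier\<close>

text \<open>
  Pontryagin's principle: for the Lagrange multiplier \<open>\<mu>\<close> of the area constraint, the optimal slope
  at \<open>x\<close> is \<open>slope (pressure a \<mu> q x)\<close>, where \<open>q\<close> is the pressure at \<open>x = a\<close>.
\<close>

definition graph_height :: "real \<Rightarrow> real \<Rightarrow> real \<Rightarrow> real" where
  "graph_height a \<mu> q = integral {0..a} (\<lambda>x. slope (pressure a \<mu> q x))"

text \<open>The area below the graph, in the form produced by integration by parts in
  \<open>ex_admissible_graph_curve\<close>.\<close>

definition graph_area :: "real \<Rightarrow> real \<Rightarrow> real \<Rightarrow> real" where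
  "graph_area a \<mu> q = integral {0..a} (\<lambda>x. (a - x) * slope (pressure a \<mu> q x))"

text \<open>The largest end pressure for which the graph still fits below height
  \<open>h\<close>.\<close>

definition end_pressure :: "real \<Rightarrow> real \<Rightarrow> real \<Rightarrow> real" where
  "end_pressure a h \<mu> = Sup {q \<in> {0..1}. graph_height a \<mu> q \<le> h}"

lemma continuous_on_slope_pressure_joint:
  "continuous_on (({0..} \<times> {0..1}) \<times> {0..a}) (\<lambda>((\<mu>, q), x). slope (pressure a \<mu> q x))"
  unfolding case_prod_unfold
proof (rule continuous_on_compose2[OF continuous_on_slope])
  show "continuous_on (({0..} \<times> {0..1}) \<times> {0..a}) (\<lambda>z. pressure a (fst (fst z)) (snd (fst z)) (snd z))"
    unfolding pressure_def by (intro continuous_intros)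
  show "(\<lambda>z. pressure a (fst (fst z)) (snd (fst z)) (snd z)) ` (({0..} \<times> {0..1}) \<times> {0..a}) \<subseteq> {..1}"
    using pressure_bounds by auto
qed

lemma continuous_on_graph_height: "continuous_on ({0..} \<times> {0..1}) (\<lambda>(\<mu>, q). graph_height a \<mu> q)"
  using integral_continuous_on_param[of "{0..} \<times> {0..1}" 0 a "\<lambda>(\<mu>, q) x. slope (pressure a \<mu> q x)"]
    continuous_on_slope_pressure_joint[of a]
  by (simp add: graph_height_def case_prod_unfold)

lemma continuous_on_graph_area: "continuous_on ({0..} \<times> {0..1}) (\<lambda>(\<mu>, q). graph_area a \<mu> q)"
proof -
  have "continuous_on (({0..} \<times> {0..1}) \<times> {0..a})
      (\<lambda>z. (a - snd z) * (\<lambda>((\<mu>, q), x). slope (pressure a \<mu> q x)) z)"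
    by (intro continuous_intros continuous_on_slope_pressure_joint)
  then show ?thesis
    using integral_continuous_on_param[of "{0..} \<times> {0..1}" 0 a "\<lambda>(\<mu>, q) x. (a - x) * slope (pressure a \<mu> q x)"]
    by (simp add: graph_area_def case_prod_unfold)
qed

lemma continuous_on_slope_pressure:
  assumes "\<mu> \<ge> 0" "q \<in> {0..1}"
  shows "continuous_on {0..a} (\<lambda>x. slope (pressure a \<mu> q x))"
  by (rule continuous_on_compose2[OF continuous_on_slope continuous_on_pressure])
     (use pressure_bounds[OF assms] in auto)

lemma graph_height_mono:
  assumes "\<mu> \<ge> 0" "\<mu>' \<ge> 0" "q \<in> {0..1}" "q' \<in> {0..1}"
    and "\<And>x. x \<in> {0..a} \<Longrightarrow> pressure a \<mu> q x \<le> pressure a \<mu>' q' x"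
  shows "graph_height a \<mu> q \<le> graph_height a \<mu>' q'"
  unfolding graph_height_def
  using assms pressure_bounds[of \<mu>' q' _ a]
  by (intro integral_le integrable_continuous_real continuous_on_slope_pressure slope_mono) auto

lemma graph_height_0: "\<mu> \<ge> 0 \<Longrightarrow> graph_height a \<mu> 0 = 0"
proof -
  assume "\<mu> \<ge> 0"
  then have "integral {0..a} (\<lambda>x. slope (pressure a \<mu> 0 x)) = integral {0..a} (\<lambda>x. 0)"
    by (intro Henstock_Kurzweil_Integration.integral_cong) (simp add: pressure_def)
  then show ?thesis by (simp add: graph_height_def)
qed

text \<open>The last claim is complementary slackness: were the pressure below 1 and the graph too
  low, the intermediate value theorem would give a larger feasible pressure.\<close>

lemma end_pressure:
  assumes h: "h > 0" and \<mu>: "\<mu> \<ge> 0"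
  shows "end_pressure a h \<mu> \<in> {0..1}" "graph_height a \<mu> (end_pressure a h \<mu>) \<le> h"
    "end_pressure a h \<mu> = 1 \<or> graph_height a \<mu> (end_pressure a h \<mu>) = h"
proof -
  define S where "S = {q \<in> {0..1}. graph_height a \<mu> q \<le> h}"
  define p where "p = end_pressure a h \<mu>"
  have p: "p = Sup S" by (simp add: p_def end_pressure_def S_def)
  have cont: "continuous_on {0..1} (graph_height a \<mu>)"
  proof -
    have "continuous_on {0..1} (\<lambda>q. case (\<mu>, q) of (\<mu>, q) \<Rightarrow> graph_height a \<mu> q)"
      using \<mu> by (intro continuous_on_compose2[OF continuous_on_graph_height] continuous_intros) auto
    then show ?thesis by simp
  qed
  have bdd: "bdd_above S" by (auto simp: S_def bdd_above_def)
  have "0 \<in> S" using graph_height_0[OF \<mu>] h by (simp add: S_def)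
  moreover have "closed S"
    unfolding S_def by (rule continuous_on_closed_Collect_le[OF cont continuous_on_const]) simp
  ultimately have "p \<in> S" unfolding p using closed_contains_Sup bdd by blast
  then have pS: "p \<in> {0..1}" "graph_height a \<mu> p \<le> h" by (auto simp: S_def)
  have "p = 1 \<or> graph_height a \<mu> p = h"
  proof (rule ccontr)
    assume *: "\<not> ?thesis"
    then have "1 \<notin> S" using cSup_upper[OF _ bdd, of 1] pS p by auto
    then have "graph_height a \<mu> p \<le> h" "h \<le> graph_height a \<mu> 1" using pS by (auto simp: S_def)
    moreover have "continuous_on {p..1} (graph_height a \<mu>)"
      using pS by (intro continuous_on_subset[OF cont]) auto
    ultimately obtain q where q: "p \<le> q" "q \<le> 1" "graph_height a \<mu> q = h"
      using IVT'[of "graph_height a \<mu>" p h 1] pS by auto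
    then have "q \<in> S" using pS by (simp add: S_def)
    then have "q \<le> p" unfolding p by (rule cSup_upper[OF _ bdd])
    then show False using q * by simp
  qed
  with pS show "end_pressure a h \<mu> \<in> {0..1}" "graph_height a \<mu> (end_pressure a h \<mu>) \<le> h"
    "end_pressure a h \<mu> = 1 \<or> graph_height a \<mu> (end_pressure a h \<mu>) = h"
    by (simp_all add: p_def)
qed

lemma le_end_pressure:
  assumes "q \<in> {0..1}" "graph_height a \<mu> q \<le> h"
  shows "q \<le> end_pressure a h \<mu>"
  unfolding end_pressure_def using assms
  by (intro cSup_upper) (auto simp: bdd_above_def)

text \<open>Lowering \<open>\<mu>'\<close> to \<open>\<mu>\<close> and at the same time \<open>q\<close> by \<open>a (\<mu>' - \<mu>)\<close> does not raise the pressure.\<close>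

lemma continuous_on_end_pressure:
  assumes a: "a > 0" and h: "h > 0"
  shows "continuous_on {0..} (end_pressure a h)"
proof -
  have *: "end_pressure a h \<mu> \<le> end_pressure a h \<mu>'"
    "end_pressure a h \<mu>' - a * (\<mu>' - \<mu>) \<le> end_pressure a h \<mu>" if "0 \<le> \<mu>" "\<mu> \<le> \<mu>'" for \<mu> \<mu>'
  proof -
    let ?q = "end_pressure a h \<mu>" and ?q' = "end_pressure a h \<mu>'"
    have \<mu>': "\<mu>' \<ge> 0" using that by simp
    note e = end_pressure[OF h that(1), of a] and e' = end_pressure[OF h \<mu>', of a]
    show "?q \<le> ?q'"
    proof (rule le_end_pressure[OF e(1)])
      have "graph_height a \<mu>' ?q \<le> graph_height a \<mu> ?q"
      proof (rule graph_height_mono[OF \<mu>' that(1) e(1) e(1)])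
        fix x assume "x \<in> {0..a}"
        then have "\<mu> * (a - x) \<le> \<mu>' * (a - x)" using that by (intro mult_right_mono) auto
        then show "pressure a \<mu>' ?q x \<le> pressure a \<mu> ?q x" by (simp add: pressure_def)
      qed
      then show "graph_height a \<mu>' ?q \<le> h" using e by simp
    qed
    define r where "r = max 0 (?q' - a * (\<mu>' - \<mu>))"
    have "a * (\<mu>' - \<mu>) \<ge> 0" using that a by simp
    then have r: "r \<in> {0..1}" using e'(1) by (auto simp: r_def)
    have "r \<le> ?q"
    proof (rule le_end_pressure[OF r])
      have "graph_height a \<mu> r \<le> graph_height a \<mu>' ?q'"
      proof (rule graph_height_mono[OF that(1) \<mu>' r e'(1)])
        fix x assume x: "x \<in> {0..a}"
        have "(\<mu>' - \<mu>) * (a - x) \<le> (\<mu>' - \<mu>) * a" using that x by (intro mult_left_mono) auto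
        then have "?q' - a * (\<mu>' - \<mu>) - \<mu> * (a - x) \<le> ?q' - \<mu>' * (a - x)"
          by (simp add: algebra_simps)
        moreover have "\<mu> * (a - x) \<ge> 0" using that x by simp
        ultimately show "pressure a \<mu> r x \<le> pressure a \<mu>' ?q' x"
          unfolding pressure_def r_def by linarith
      qed
      then show "graph_height a \<mu> r \<le> h" using e' by simp
    qed
    then show "?q' - a * (\<mu>' - \<mu>) \<le> ?q" by (simp add: r_def)
  qed
  \<comment> \<open>By the two estimates, increasing the multiplier raises the end pressure by at
    most \<open>a\<close> times the increment.\<close>
  have "a-lipschitz_on {0..} (end_pressure a h)"
  proof (rule lipschitz_onI)
    fix \<mu> \<mu>' :: real assume m: "\<mu> \<in> {0..}" "\<mu>' \<in> {0..}"
    then consider "0 \<le> \<mu>" "\<mu> \<le> \<mu>'" | "0 \<le> \<mu>'" "\<mu>' \<le> \<mu>" by fastforce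
    then show "dist (end_pressure a h \<mu>) (end_pressure a h \<mu>') \<le> a * dist \<mu> \<mu>'"
      by cases (use * in \<open>fastforce simp: dist_real_def\<close>)+
  qed (use a in simp)
  then show ?thesis by (rule lipschitz_on_continuous_on)
qed

text \<open>The equality case of weak duality. The second formula serves for explicit evaluation at
  \<open>\<mu> = 0\<close>.\<close>

lemma ex_admissible_curve_multiplier:
  assumes a: "a > 0" and h: "h > 0" and \<mu>: "\<mu> \<ge> 0"
  defines "q \<equiv> end_pressure a h \<mu>"
  shows "\<exists>\<gamma>\<in>admissible_curves a h (graph_area a \<mu> q).
    curve_functional \<gamma> = dual_value a h \<mu> q - \<mu> * graph_area a \<mu> q \<and>
    curve_functional \<gamma> = h - graph_height a \<mu> q + integral {0..a} (\<lambda>x. newton_density 1 (slope (pressure a \<mu> q x)))"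
proof -
  define p where "p = pressure a \<mu> q"
  note q = end_pressure[OF h \<mu>, of a, folded q_def]
  have p01: "p x \<in> {0..1}" if "x \<in> {0..a}" for x
    using pressure_bounds[OF \<mu> q(1)] that by (simp add: p_def)
  have s_cont: "continuous_on {0..a} (\<lambda>x. slope (p x))"
    unfolding p_def by (rule continuous_on_slope_pressure[OF \<mu> q(1)])
  have c_cont: "continuous_on {0..a} (\<lambda>x. density_conj (p x))"
    unfolding p_def by (rule continuous_on_density_conj_pressure[OF \<mu> q(1)])
  obtain \<gamma> where \<gamma>: "\<gamma> \<in> admissible_curves a h (graph_area a \<mu> q)"
    "curve_functional \<gamma> = h - graph_height a \<mu> q + integral {0..a} (\<lambda>x. newton_density 1 (slope (p x)))"
    using ex_admissible_graph_curve[OF a s_cont, of 0 h] slope_bounds p01 q(2)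
    by (auto simp: graph_area_def graph_height_def p_def)
  \<comment> \<open>Where the pressure is nonzero it equals its affine expression; where it is 0,
    slope, density and conjugate all vanish.\<close>
  have "newton_density 1 (slope (p x)) = q * slope (p x) - \<mu> * ((a - x) * slope (p x)) - density_conj (p x)" for x
  proof (cases "p x = 0")
    case False
    then have "p x = q - \<mu> * (a - x)" by (auto simp: p_def pressure_def max_def split: if_splits)
    moreover have "q * slope (p x) - \<mu> * ((a - x) * slope (p x)) = (q - \<mu> * (a - x)) * slope (p x)"
      by (simp add: left_diff_distrib)
    ultimately have "q * slope (p x) - \<mu> * ((a - x) * slope (p x)) = p x * slope (p x)" by simp
    then show ?thesis by (simp add: density_conj_def)
  qed simp
  then have "integral {0..a} (\<lambda>x. newton_density 1 (slope (p x)))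
      = integral {0..a} (\<lambda>x. q * slope (p x) - \<mu> * ((a - x) * slope (p x)) - density_conj (p x))"
    by simp
  also have "\<dots> = q * graph_height a \<mu> q - \<mu> * graph_area a \<mu> q - integral {0..a} (\<lambda>x. density_conj (p x))"
    by (subst integral_diff integral_mult_right,
        auto intro!: integrable_continuous_real continuous_intros s_cont c_cont
          simp: graph_height_def graph_area_def p_def[symmetric])+
  finally have "curve_functional \<gamma> = (1 - q) * (h - graph_height a \<mu> q) + q * h
      - integral {0..a} (\<lambda>x. density_conj (p x)) - \<mu> * graph_area a \<mu> q"
    using \<gamma>(2) by (simp add: algebra_simps)
  \<comment> \<open>Slackness: the vertical end segment is trivial unless
    \<open>q = 1\<close>.\<close>
  also have "(1 - q) * (h - graph_height a \<mu> q) = 0" using q(3) by auto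
  finally show ?thesis using \<gamma> by (auto simp: dual_value_def p_def)
qed

text \<open>Positive pressure forces \<open>a - x < 1 / \<mu>\<close>, which bounds the integrand.
  Large multipliers thus produce small areas.\<close>

lemma graph_area_le:
  assumes a: "a > 0" and \<mu>: "\<mu> > 0" and q: "q \<in> {0..1}"
  shows "graph_area a \<mu> q \<le> a / \<mu>"
proof -
  have "graph_area a \<mu> q \<le> integral {0..a} (\<lambda>x. 1 / \<mu>)"
    unfolding graph_area_def
  proof (rule integral_le)
    show "(\<lambda>x. (a - x) * slope (pressure a \<mu> q x)) integrable_on {0..a}"
      using \<mu> q by (intro integrable_continuous_real continuous_intros continuous_on_slope_pressure) auto
    fix x assume x: "x \<in> {0..a}"
    have p: "pressure a \<mu> q x \<in> {0..1}" using \<mu> q x by (intro pressure_bounds) auto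
    show "(a - x) * slope (pressure a \<mu> q x) \<le> 1 / \<mu>"
    proof (cases "\<mu> * (a - x) \<le> 1")
      case True
      then have "a - x \<le> 1 / \<mu>" using \<mu> by (simp add: field_simps)
      then have "(a - x) * slope (pressure a \<mu> q x) \<le> 1 / \<mu> * 1"
        using slope_bounds[OF p] x \<mu> by (intro mult_mono) auto
      then show ?thesis by simp
    next
      case False
      then have "pressure a \<mu> q x = 0" using q by (simp add: pressure_def)
      then show ?thesis using \<mu> by simp
    qed
  qed auto
  then show ?thesis using a by simp
qed

text \<open>For \<open>\<mu> = 0\<close> the pressure is constant and the graph is a straight line:
  the diagonal if \<open>h \<le> a\<close>, otherwise a line of slope 1.\<close>

lemma multiplier_0:
  assumes a: "a > 0" and h: "h > 0"
  shows "graph_height a 0 q = a * slope (max 0 q)" "graph_area a 0 q = a\<^sup>2 / 2 * slope (max 0 q)"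
    "slope (end_pressure a h 0) = min 1 (h / a)"
proof -
  have height: "graph_height a 0 q = a * slope (max 0 q)" for q
    using a by (simp add: graph_height_def pressure_def)
  then show "graph_height a 0 q = a * slope (max 0 q)" .
  have "((\<lambda>x. a - x) has_integral (a * a - a\<^sup>2 / 2) - (a * 0 - 0\<^sup>2 / 2)) {0..a}"
  proof (rule fundamental_theorem_of_calculus)
    show "((\<lambda>x. a * x - x\<^sup>2 / 2) has_vector_derivative a - x) (at x within {0..a})" for x
      unfolding has_real_derivative_iff_has_vector_derivative[symmetric]
      by (auto intro!: derivative_eq_intros)
  qed (use a in simp)
  then have "integral {0..a} (\<lambda>x. a - x) = a\<^sup>2 / 2"
    by (simp add: integral_unique power2_eq_square)
  then show "graph_area a 0 q = a\<^sup>2 / 2 * slope (max 0 q)"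
    by (simp add: graph_area_def pressure_def)
  define e where "e = end_pressure a h 0"
  note e = end_pressure[OF h order_refl, of a, folded e_def]
  have "max 0 e = e" "slope e \<le> 1" using e slope_bounds[of e] by auto
  then have "a * slope e \<le> h" "slope e \<le> 1" "slope e = 1 \<or> a * slope e = h"
    using e height[of e] by auto
  then have "slope e = min 1 (h / a)"
    using a by (auto simp: min_def field_simps)
  then show "slope (end_pressure a h 0) = min 1 (h / a)" by (simp add: e_def)
qed

lemma ex_multiplier:
  assumes a: "a > 0" and h: "h > 0" and L: "0 < L" "L \<le> min (a * h) (a\<^sup>2) / 2"
  shows "\<exists>\<mu>\<ge>0. graph_area a \<mu> (end_pressure a h \<mu>) = L \<and> (L < min (a * h) (a\<^sup>2) / 2 \<longrightarrow> \<mu> > 0)"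
proof -
  define A where "A \<mu> = graph_area a \<mu> (end_pressure a h \<mu>)" for \<mu>
  have A0: "A 0 = min (a * h) (a\<^sup>2) / 2"
  proof -
    have "max 0 (end_pressure a h 0) = end_pressure a h 0"
      using end_pressure(1)[OF h order_refl, of a] by auto
    then have "A 0 = a\<^sup>2 / 2 * min 1 (h / a)"
      using multiplier_0[OF a h] by (simp add: A_def)
    also have "\<dots> = min (a\<^sup>2 / 2) (a * h / 2)"
      using a by (simp add: min_mult_distrib_left power2_eq_square)
    also have "\<dots> = min (a * h) (a\<^sup>2) / 2" by (simp add: min_def)
    finally show ?thesis .
  qed
  have "continuous_on {0..} (\<lambda>\<mu>. case (\<mu>, end_pressure a h \<mu>) of (\<mu>, q) \<Rightarrow> graph_area a \<mu> q)"
    using end_pressure(1)[OF h]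
    by (intro continuous_on_compose2[OF continuous_on_graph_area] continuous_intros
        continuous_on_end_pressure a h) auto
  then have cont: "continuous_on {0..a / L} A"
    unfolding A_def by (auto elim: continuous_on_subset)
  \<comment> \<open>The multiplier \<open>a / L\<close> is the one at which the bound
    \<open>a / \<mu>\<close> equals \<open>L\<close>; it is the far end for the intermediate value
    theorem.\<close>
  have "A (a / L) \<le> a / (a / L)"
    unfolding A_def using a L end_pressure(1)[OF h, of "a / L" a] by (intro graph_area_le) auto
  then have "A (a / L) \<le> L" using a by simp
  then obtain \<mu> where "0 \<le> \<mu>" "A \<mu> = L"
    using IVT2'[of A "a / L" L 0] cont L A0 a by auto
  then show ?thesis using A0 by (intro exI[of _ \<mu>]) (auto simp: A_def order_le_less)
qed

section \<open>The minimal value\<close>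

text \<open>The area of the curve with multiplier 0, covering \<open>h \<le> a\<close> and
  \<open>h > a\<close> at once.\<close>

definition plateau_start :: "real \<Rightarrow> real \<Rightarrow> real" where
  "plateau_start a h = min (a * h) (a\<^sup>2) / 2"

lemma plateau_start_bounds:
  assumes "a > 0" "h > 0"
  shows "0 < plateau_start a h" "plateau_start a h < a * h"
proof -
  have "a * h > 0" "a\<^sup>2 > 0" using assms by simp_all
  then show "0 < plateau_start a h" "plateau_start a h < a * h"
    unfolding plateau_start_def by linarith+
qed

lemma plateau_start_eq:
  assumes "a > 0"
  shows "plateau_start a h = (if h \<le> a then a * h / 2 else a\<^sup>2 / 2)"
  using assms by (simp add: plateau_start_def power2_eq_square min_def)

section \<open>Attainment of the minimum\<close>

lemma F_min_eqI:
  assumes "\<gamma> \<in> admissible_curves a h L"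
    and "\<And>\<gamma>'. \<gamma>' \<in> admissible_curves a h L \<Longrightarrow> curve_functional \<gamma> \<le> curve_functional \<gamma>'"
  shows "F_min a h L = curve_functional \<gamma>"
  unfolding F_min_def by (rule Least_equality) (use assms in auto)

lemma F_min_eq_dual:
  assumes a: "a > 0" and h: "h > 0" and L: "0 < L" "L \<le> plateau_start a h"
  shows "\<exists>\<mu>\<ge>0. \<exists>q\<in>{0..1}. (L < plateau_start a h \<longrightarrow> \<mu> > 0) \<and>
    F_min a h L = dual_value a h \<mu> q - \<mu> * L \<and> (\<exists>\<gamma>\<in>admissible_curves a h L. curve_functional \<gamma> = F_min a h L)"
proof -
  obtain \<mu> where \<mu>: "\<mu> \<ge> 0" "L < plateau_start a h \<longrightarrow> \<mu> > 0"
    and L_eq: "graph_area a \<mu> (end_pressure a h \<mu>) = L"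
    using ex_multiplier[OF a h] L unfolding plateau_start_def by blast
  define q where "q = end_pressure a h \<mu>"
  have q: "q \<in> {0..1}" unfolding q_def by (rule end_pressure(1)[OF h \<mu>(1)])
  obtain \<gamma> where \<gamma>: "\<gamma> \<in> admissible_curves a h L" "curve_functional \<gamma> = dual_value a h \<mu> q - \<mu> * L"
    using ex_admissible_curve_multiplier[OF a h \<mu>(1)] unfolding L_eq q_def by blast
  have "F_min a h L = curve_functional \<gamma>"
    by (rule F_min_eqI[OF \<gamma>(1)]) (use dual_value_le_curve_functional[OF a \<mu>(1) q] \<gamma>(2) in simp)
  then show ?thesis using \<mu> q \<gamma> by (intro exI[of _ \<mu>]) auto
qed

text \<open>With \<open>\<mu> = 0\<close> the dual bound does not depend on \<open>L\<close>, so
  this value bounds \<open>F_min\<close> from below for all areas.\<close>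

lemma F_min_at_min:
  assumes a: "a > 0" and h: "h > 0"
  shows "F_min a h (plateau_start a h) = (if h \<le> a then h ^ 3 / (a\<^sup>2 + h\<^sup>2) else h - a / 2)"
    "\<exists>q\<in>{0..1}. F_min a h (plateau_start a h) = dual_value a h 0 q"
proof -
  define q s where "q = end_pressure a h 0" and "s = min 1 (h / a)"
  have q: "q \<in> {0..1}" unfolding q_def by (rule end_pressure(1)[OF h order_refl])
  then have q0: "max 0 q = q" by auto
  have s: "slope q = s" unfolding q_def s_def by (rule multiplier_0[OF a h])
  have area: "graph_area a 0 q = plateau_start a h"
  proof -
    have "graph_area a 0 q = a\<^sup>2 / 2 * min 1 (h / a)"
      using multiplier_0(2)[OF a h, of q] by (simp add: q0 s s_def)
    also have "\<dots> = plateau_start a h"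
      using a by (auto simp: plateau_start_def min_def field_simps power2_eq_square)
    finally show ?thesis .
  qed
  obtain \<gamma> where \<gamma>: "\<gamma> \<in> admissible_curves a h (plateau_start a h)"
      "curve_functional \<gamma> = dual_value a h 0 q"
      "curve_functional \<gamma> = h - graph_height a 0 q + integral {0..a} (\<lambda>x. newton_density 1 (slope (pressure a 0 q x)))"
    using ex_admissible_curve_multiplier[OF a h order_refl] area unfolding q_def by auto
  have F: "F_min a h (plateau_start a h) = curve_functional \<gamma>"
    by (rule F_min_eqI[OF \<gamma>(1)]) (use dual_value_le_curve_functional[OF a order_refl q] \<gamma>(2) in simp)
  then show "\<exists>q\<in>{0..1}. F_min a h (plateau_start a h) = dual_value a h 0 q"
    using \<gamma>(2) q by auto
  have "s \<ge> 0" using a h by (simp add: s_def)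
  then have "curve_functional \<gamma> = h - a * s + a * (s ^ 3 / (1 + s\<^sup>2))"
    using \<gamma>(3) a multiplier_0(1)[OF a h, of q] by (simp add: pressure_def q0 s newton_density_1)
  also have "\<dots> = (if h \<le> a then h ^ 3 / (a\<^sup>2 + h\<^sup>2) else h - a / 2)"
  proof (cases "h \<le> a")
    case True
    then have hs: "h = a * s" using a by (simp add: s_def min_def)
    have "a\<^sup>2 + h\<^sup>2 = a\<^sup>2 * (1 + s\<^sup>2)" "h ^ 3 = a\<^sup>2 * (a * s ^ 3)"
      unfolding hs by (simp_all add: algebra_simps power2_eq_square power3_eq_cube)
    then show ?thesis using True hs a by simp
  next
    case False
    then have "s = 1" using a by (simp add: s_def min_def field_simps)
    then show ?thesis using False by simp
  qed
  finally show "F_min a h (plateau_start a h) = (if h \<le> a then h ^ 3 / (a\<^sup>2 + h\<^sup>2) else h - a / 2)"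
    using F by simp
qed

lemma dual_value_vertical:
  assumes "a > 0"
  shows "dual_value a h 0 1 = h - a / 2"
  using assms by (simp add: dual_value_def pressure_def)

lemma F_min_plateau:
  assumes a: "a > 0" and h: "h > 0" and L: "plateau_start a h \<le> L" "L \<le> a * h - plateau_start a h"
  shows "F_min a h L = F_min a h (plateau_start a h)"
    "\<exists>\<gamma>\<in>admissible_curves a h L. curve_functional \<gamma> = F_min a h L"
proof -
  have "F_min a h L = F_min a h (plateau_start a h) \<and>
    (\<exists>\<gamma>\<in>admissible_curves a h L. curve_functional \<gamma> = F_min a h L)"
  proof (cases "h \<le> a")
    case True
    then have "L = plateau_start a h" using L plateau_start_eq[OF a, of h] by simp
    then show ?thesis
      using F_min_eq_dual[OF a h, of L] plateau_start_bounds[OF a h] by auto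
  next
    case False
    then have M: "plateau_start a h = a\<^sup>2 / 2" using plateau_start_eq[OF a, of h] by simp
    \<comment> \<open>Lifting the line of slope 1 by \<open>b\<close> adds the area
      \<open>a * b\<close> and keeps the functional at \<open>h - a / 2\<close>, the dual value for
      \<open>\<mu> = 0\<close> and \<open>q = 1\<close>.\<close>
    define b where "b = (L - a\<^sup>2 / 2) / a"
    have b: "b \<ge> 0" "b + a \<le> h" "a * b = L - a\<^sup>2 / 2"
      using L a unfolding M by (auto simp: b_def field_simps power2_eq_square)
    have area: "a * b + integral {0..a} (\<lambda>z. (a - z) * 1) = L"
      using multiplier_0(2)[OF a h, of 1] b(3) by (simp add: graph_area_def pressure_def)
    have "b + integral {0..a} (\<lambda>_. 1) \<le> h" using a b by simp
    then obtain \<gamma> where \<gamma>: "\<gamma> \<in> admissible_curves a h L"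
        "curve_functional \<gamma> = h - integral {0..a} (\<lambda>_. 1) + integral {0..a} (\<lambda>_. newton_density 1 1)"
      using ex_admissible_graph_curve[OF a continuous_on_const[of _ 1] _ b(1), of h] unfolding area by auto
    then have F: "curve_functional \<gamma> = h - a / 2" using a by (simp add: newton_density_1)
    have "F_min a h L = curve_functional \<gamma>"
      by (rule F_min_eqI[OF \<gamma>(1)])
         (use dual_value_le_curve_functional[OF a order_refl, of 1] dual_value_vertical[OF a] F in auto)
    then show ?thesis using \<gamma>(1) F F_min_at_min(1)[OF a h] False by auto
  qed
  then show "F_min a h L = F_min a h (plateau_start a h)"
    "\<exists>\<gamma>\<in>admissible_curves a h L. curve_functional \<gamma> = F_min a h L" by auto
qed

lemma F_min_attained:
  assumes a: "a > 0" and h: "h > 0" and L: "L \<in> {0<..<a * h}"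
  shows "\<exists>\<gamma>\<in>admissible_curves a h L. curve_functional \<gamma> = F_min a h L"
proof -
  consider "L \<le> plateau_start a h"
    | "plateau_start a h \<le> L" "L \<le> a * h - plateau_start a h"
    | "a * h - plateau_start a h \<le> L" by linarith
  then show ?thesis
  proof cases
    case 1
    then show ?thesis using F_min_eq_dual[OF a h, of L] L by auto
  next
    case 2
    then show ?thesis by (rule F_min_plateau(2)[OF a h])
  next
    case 3
    then have "0 < a * h - L" "a * h - L \<le> plateau_start a h" using L by auto
    from F_min_eq_dual[OF a h this] obtain \<gamma> where
      "\<gamma> \<in> admissible_curves a h (a * h - L)" "curve_functional \<gamma> = F_min a h (a * h - L)"
      by blast
    then show ?thesis
      using admissible_curves_reflect[of \<gamma> a h "a * h - L"] F_min_symmetric[of a h L] by auto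
  qed
qed

section \<open>Subgradients, continuity and monotonicity\<close>

lemma dual_value_le_F_min:
  assumes "a > 0" "h > 0" "L \<in> {0<..<a * h}" "\<mu> \<ge> 0" "q \<in> {0..1}"
  shows "dual_value a h \<mu> q - \<mu> * L \<le> F_min a h L"
  using F_min_attained[OF assms(1-3)] dual_value_le_curve_functional[OF assms(1,4,5)] by metis

lemma F_min_plateau_start_le:
  assumes a: "a > 0" and h: "h > 0" and L: "L \<in> {0<..<a * h}"
  shows "F_min a h (plateau_start a h) \<le> F_min a h L"
proof -
  obtain q where "q \<in> {0..1}" "F_min a h (plateau_start a h) = dual_value a h 0 q"
    using F_min_at_min(2)[OF a h] by blast
  then show ?thesis using dual_value_le_F_min[OF a h L order_refl, of q] by simp
qed

text \<open>The dual pair that is optimal at \<open>L\<close> still gives a lower bound at every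
  \<open>L'\<close>, so \<open>- \<mu>\<close> is a subgradient.\<close>

lemma F_min_subgradient:
  assumes a: "a > 0" and h: "h > 0" and L: "0 < L" "L \<le> plateau_start a h"
  shows "\<exists>\<mu>\<ge>0. (L < plateau_start a h \<longrightarrow> \<mu> > 0) \<and>
    (\<forall>L'\<in>{0<..<a * h}. F_min a h L - \<mu> * (L' - L) \<le> F_min a h L')"
proof -
  obtain \<mu> q where \<mu>: "\<mu> \<ge> 0" "L < plateau_start a h \<longrightarrow> \<mu> > 0" "q \<in> {0..1}"
    "F_min a h L = dual_value a h \<mu> q - \<mu> * L"
    using F_min_eq_dual[OF assms] by blast
  have "F_min a h L - \<mu> * (L' - L) \<le> F_min a h L'" if "L' \<in> {0<..<a * h}" for L'
    using dual_value_le_F_min[OF a h that \<mu>(1,3)] \<mu>(4) by (simp add: algebra_simps)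
  with \<mu> show ?thesis by blast
qed

lemma convex_on_subgradients:
  fixes f :: "real \<Rightarrow> real"
  assumes "convex S" and "\<And>z. z \<in> S \<Longrightarrow> \<exists>k. \<forall>x\<in>S. f z + k * (x - z) \<le> f x"
  shows "convex_on S f"
proof (rule convex_onI[OF _ assms(1)])
  fix t x y :: real assume t: "0 < t" "t < 1" and xy: "x \<in> S" "y \<in> S"
  define z where "z = (1 - t) * x + t * y"
  have "z \<in> S" using convexD[OF assms(1) xy, of "1 - t" t] t by (simp add: z_def)
  then obtain k where k: "\<And>w. w \<in> S \<Longrightarrow> f z + k * (w - z) \<le> f w" using assms(2) by blast
  have "f z = (1 - t) * (f z + k * (x - z)) + t * (f z + k * (y - z))"
    by (simp add: z_def algebra_simps)
  also have "\<dots> \<le> (1 - t) * f x + t * f y"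
    using t k[OF xy(1)] k[OF xy(2)] by (intro add_mono mult_left_mono) auto
  finally show "f ((1 - t) *\<^sub>R x + t *\<^sub>R y) \<le> (1 - t) * f x + t * f y"
    by (simp add: z_def)
qed

text \<open>There is a subgradient at every \<open>L\<close>: \<open>- \<mu>\<close> left of the
  plateau, 0 on it, and \<mu> on the right by reflection. Convexity on an open interval gives
  continuity.\<close>

lemma continuous_on_F_min:
  assumes a: "a > 0" and h: "h > 0"
  shows "continuous_on {0<..<a * h} (F_min a h)"
proof -
  have "convex_on {0<..<a * h} (F_min a h)"
  proof (rule convex_on_subgradients)
    fix L assume L: "L \<in> {0<..<a * h}"
    consider "L \<le> plateau_start a h"
      | "plateau_start a h \<le> L" "L \<le> a * h - plateau_start a h"
      | "a * h - plateau_start a h \<le> L" by linarith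
    then show "\<exists>k. \<forall>L'\<in>{0<..<a * h}. F_min a h L + k * (L' - L) \<le> F_min a h L'"
    proof cases
      case 1
      have "0 < L" using L by simp
      from F_min_subgradient[OF a h this 1] obtain \<mu> where
        "\<And>L'. L' \<in> {0<..<a * h} \<Longrightarrow> F_min a h L - \<mu> * (L' - L) \<le> F_min a h L'" by blast
      then show ?thesis by (intro exI[of _ "- \<mu>"]) auto
    next
      case 2
      then show ?thesis
        using F_min_plateau_start_le[OF a h] F_min_plateau(1)[OF a h 2] by (intro exI[of _ 0]) auto
    next
      case 3
      then have "0 < a * h - L" "a * h - L \<le> plateau_start a h" using L by auto
      from F_min_subgradient[OF a h this] obtain \<mu> where \<mu>: "\<And>L'. L' \<in> {0<..<a * h} \<Longrightarrow>
          F_min a h (a * h - L) - \<mu> * (L' - (a * h - L)) \<le> F_min a h L'" by blast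
      have "F_min a h L + \<mu> * (L' - L) \<le> F_min a h L'" if "L' \<in> {0<..<a * h}" for L'
        using \<mu>[of "a * h - L'"] that by (simp add: F_min_symmetric algebra_simps)
      then show ?thesis by blast
    qed
  qed simp
  then show ?thesis by (rule convex_on_continuous[OF open_greaterThanLessThan])
qed

lemma strict_antimono_on_F_min:
  assumes a: "a > 0" and h: "h > 0"
  shows "strict_antimono_on {0<..plateau_start a h} (F_min a h)"
proof -
  define M where "M = plateau_start a h"
  have M: "M < a * h" using plateau_start_bounds[OF a h] by (simp add: M_def)
  have *: "F_min a h L' < F_min a h L" if "0 < L" "L < L'" "L' < M" for L L'
  proof -
    have "L \<in> {0<..<a * h}" using that M by simp
    moreover have "0 < L'" "L' \<le> plateau_start a h" "L' < plateau_start a h"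
      using that by (auto simp: M_def)
    ultimately obtain \<mu> where \<mu>: "\<mu> > 0" "F_min a h L' - \<mu> * (L - L') \<le> F_min a h L"
      using F_min_subgradient[OF a h, of L'] by blast
    moreover have "\<mu> * (L - L') < 0" using \<mu>(1) that by (simp add: mult_pos_neg)
    ultimately show ?thesis by linarith
  qed
  have **: "F_min a h M \<le> F_min a h L" if "L \<in> {0<..<a * h}" for L
    unfolding M_def by (rule F_min_plateau_start_le[OF a h that])
  show ?thesis
  proof (rule monotone_onI, fold M_def)
    fix L L' assume L: "L \<in> {0<..M}" "L' \<in> {0<..M}" "L < L'"
    show "F_min a h L' < F_min a h L"
    proof (cases "L' < M")
      case True
      then show ?thesis using * L by auto
    next
      case False
      \<comment> \<open>The multiplier at \<open>M\<close> may be 0, so strictness comes from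
        comparing with the midpoint.\<close>
      then have "L' = M" using L by simp
      then have "F_min a h L' \<le> F_min a h ((L + L') / 2)"
        using L M by (auto intro!: **)
      also have "\<dots> < F_min a h L" using * L by auto
      finally show ?thesis .
    qed
  qed
qed

section \<open>The range of the minimal value\<close>

text \<open>Left of the plateau the dual expression is \<open>q * h \<le> h\<close> minus a
  nonnegative integral and minus \<open>\<mu> * L > 0\<close>. Other areas follow by comparison and
  symmetry.\<close>

lemma F_min_less:
  assumes a: "a > 0" and h: "h > 0" and L: "L \<in> {0<..<a * h}"
  shows "F_min a h L < h"
proof -
  let ?M = "plateau_start a h"
  note M = plateau_start_bounds(1)[OF a h]
  have *: "F_min a h L < h" if L: "0 < L" "L < ?M" for L
  proof -
    obtain \<mu> q where \<mu>: "\<mu> > 0" "q \<in> {0..1}" "F_min a h L = dual_value a h \<mu> q - \<mu> * L"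
      using F_min_eq_dual[OF a h, of L] L by auto
    have "integral {0..a} (\<lambda>x. density_conj (pressure a \<mu> q x)) \<ge> 0"
    proof (rule integral_nonneg)
      show "(\<lambda>x. density_conj (pressure a \<mu> q x)) integrable_on {0..a}"
        using \<mu> by (intro integrable_continuous_real continuous_on_density_conj_pressure) auto
      show "density_conj (pressure a \<mu> q x) \<ge> 0" if "x \<in> {0..a}" for x
        using density_conj_bounds[OF pressure_bounds[of \<mu> q x a]] \<mu> that by auto
    qed
    moreover have "q * h \<le> h" using \<mu>(2) h by (simp add: mult_left_le_one_le)
    moreover have "\<mu> * L > 0" using \<mu> L by simp
    ultimately show ?thesis using \<mu>(3) by (simp add: dual_value_def)
  qed
  have **: "F_min a h L < h" if "0 < L" "L \<le> ?M" for L
  proof (cases "L < ?M")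
    case False
    then have "F_min a h L < F_min a h (?M / 2)"
      using monotone_onD[OF strict_antimono_on_F_min[OF a h], of "?M / 2" L] that M by auto
    then show ?thesis using *[of "?M / 2"] M by linarith
  qed (use * that in auto)
  consider "L \<le> ?M" | "?M \<le> L" "L \<le> a * h - ?M" | "a * h - ?M \<le> L" by linarith
  then show ?thesis
  proof cases
    case 2
    then show ?thesis using F_min_plateau(1)[OF a h 2] **[of ?M] M by simp
  next
    case 3
    then show ?thesis using **[of "a * h - L"] L by (simp add: F_min_symmetric)
  qed (use ** L in auto)
qed

text \<open>For large \<open>\<mu>\<close> the pressure with \<open>q = 1\<close> vanishes except on an interval of length \<open>1 / \<mu>\<close>.\<close>

lemma dual_value_1_ge:
  assumes a: "a > 0" and \<mu>: "\<mu> \<ge> 1 / a"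
  shows "h - 1 / \<mu> \<le> dual_value a h \<mu> 1"
proof -
  define H where "H x = density_conj (pressure a \<mu> 1 x)" for x
  have \<mu>0: "\<mu> > 0" using \<mu> a by (meson divide_pos_pos less_le_trans zero_less_one)
  then have c: "0 \<le> a - 1 / \<mu>" "a - 1 / \<mu> \<le> a" using \<mu> a by (simp_all add: field_simps)
  have cont: "continuous_on {0..a} H"
    unfolding H_def using \<mu>0 by (intro continuous_on_density_conj_pressure) auto
  have "integral {0..a - 1 / \<mu>} H = integral {0..a - 1 / \<mu>} (\<lambda>x. 0)"
  proof (rule Henstock_Kurzweil_Integration.integral_cong)
    fix x assume "x \<in> {0..a - 1 / \<mu>}"
    then have "1 \<le> \<mu> * (a - x)" using \<mu>0 by (simp add: field_simps)
    then show "H x = 0" by (simp add: H_def pressure_def)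
  qed
  moreover have "integral {a - 1 / \<mu>..a} H \<le> integral {a - 1 / \<mu>..a} (\<lambda>x. 1)"
  proof (rule integral_le)
    show "H integrable_on {a - 1 / \<mu>..a}"
      using c by (intro integrable_continuous_real continuous_on_subset[OF cont]) auto
    show "H x \<le> 1" if "x \<in> {a - 1 / \<mu>..a}" for x
      using density_conj_bounds[OF pressure_bounds[of \<mu> 1 x a]] \<mu>0 that by (auto simp: H_def)
  qed auto
  moreover have "integral {0..a - 1 / \<mu>} H + integral {a - 1 / \<mu>..a} H = integral {0..a} H"
    using c cont by (intro Henstock_Kurzweil_Integration.integral_combine integrable_continuous_real)
  ultimately have "integral {0..a} H \<le> 1 / \<mu>" using c by simp
  then show ?thesis by (simp add: dual_value_def H_def[abs_def])
qed

lemma F_min_image: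
  assumes a: "a > 0" and h: "h > 0"
  shows "F_min a h ` {0<..<a * h} = {F_min a h (plateau_start a h)..<h}"
proof (intro equalityI subsetI)
  let ?M = "plateau_start a h"
  note M = plateau_start_bounds[OF a h]
  fix v
  {
    assume "v \<in> F_min a h ` {0<..<a * h}"
    then obtain L where L: "L \<in> {0<..<a * h}" "v = F_min a h L" by blast
    have "F_min a h ?M \<le> F_min a h L"
      by (rule F_min_plateau_start_le[OF a h L(1)])
    then show "v \<in> {F_min a h ?M..<h}" using F_min_less[OF a h L(1)] L(2) by simp
  next
    assume v: "v \<in> {F_min a h ?M..<h}"
    define \<epsilon> where "\<epsilon> = (h - v) / 2"
    have \<epsilon>: "\<epsilon> > 0" using v by (simp add: \<epsilon>_def)
    \<comment> \<open>Both losses \<open>1 / \<mu>\<close> and \<open>\<mu> * L\<close> in the dual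
      bound become at most \<epsilon>, and \<open>h - 2 * \<epsilon> = v\<close>. So
      \<open>F_min\<close> is at least \<open>v\<close> at the small area \<open>L\<close>, and the
      intermediate value theorem applies between \<open>L\<close> and the plateau.\<close>
    define \<mu> where "\<mu> = max (1 / a) (1 / \<epsilon>)"
    have \<mu>: "\<mu> \<ge> 1 / a" "\<mu> \<ge> 1 / \<epsilon>" "\<mu> > 0" using a by (auto simp: \<mu>_def less_max_iff_disj)
    then have "1 / \<mu> \<le> \<epsilon>" using \<epsilon> by (simp add: field_simps)
    define L where "L = min (\<epsilon> / \<mu>) ?M"
    have L: "0 < L" "L \<le> ?M" "\<mu> * L \<le> \<epsilon>"
      using \<epsilon> \<mu> M by (auto simp: L_def min_def field_simps)
    have "h - 1 / \<mu> - \<mu> * L \<le> F_min a h L"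
      using dual_value_1_ge[OF a \<mu>(1), of h] dual_value_le_F_min[OF a h, of L \<mu> 1] L M \<mu> by simp
    then have "v \<le> F_min a h L" using \<open>1 / \<mu> \<le> \<epsilon>\<close> L by (simp add: \<epsilon>_def)
    moreover have "continuous_on {L..?M} (F_min a h)"
      using L M by (intro continuous_on_subset[OF continuous_on_F_min[OF a h]]) auto
    ultimately obtain L' where "L \<le> L'" "L' \<le> ?M" "F_min a h L' = v"
      using IVT2'[of "F_min a h" ?M v L] v L by auto
    then show "v \<in> F_min a h ` {0<..<a * h}" using L M by (intro image_eqI[of _ _ L']) auto
  }
qed

lemma strict_mono_on_F_min:
  assumes a: "a > 0" and h: "h > 0"
  shows "strict_mono_on {a * h - plateau_start a h..<a * h} (F_min a h)"
proof (rule monotone_onI)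
  fix L L' assume L: "L \<in> {a * h - plateau_start a h..<a * h}"
    "L' \<in> {a * h - plateau_start a h..<a * h}" "L < L'"
  show "F_min a h L < F_min a h L'"
    using monotone_onD[OF strict_antimono_on_F_min[OF a h], of "a * h - L'" "a * h - L"] L
    by (simp add: F_min_symmetric)
qed

theorem theorem2p5:
  fixes a h :: real
  assumes "a > 0" and "h > 0"
  shows "continuous_on {0<..<a * h} (\<lambda>L. F_min a h L)
    \<and> (\<forall>L\<in>{0<..<a * h}. F_min a h L = F_min a h (a * h - L))
    \<and> (h \<le> a \<longrightarrow>
         strict_antimono_on {0<..a * h / 2} (\<lambda>L. F_min a h L)
       \<and> strict_mono_on {a * h / 2..<a * h} (\<lambda>L. F_min a h L)
       \<and> (\<lambda>L. F_min a h L) ` {0<..<a * h} = {h ^ 3 / (a\<^sup>2 + h\<^sup>2)..<h})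
    \<and> (h > a \<longrightarrow>
         strict_antimono_on {0<..a\<^sup>2 / 2} (\<lambda>L. F_min a h L)
       \<and> (\<lambda>L. F_min a h L) constant_on {a\<^sup>2 / 2..a * h - a\<^sup>2 / 2}
       \<and> strict_mono_on {a * h - a\<^sup>2 / 2..<a * h} (\<lambda>L. F_min a h L)
       \<and> (\<lambda>L. F_min a h L) ` {0<..<a * h} = {h - a / 2..<h})"
proof (intro conjI impI)
  show "continuous_on {0<..<a * h} (\<lambda>L. F_min a h L)"
    using continuous_on_F_min[OF assms] .
  show "\<forall>L\<in>{0<..<a * h}. F_min a h L = F_min a h (a * h - L)"
    by (simp add: F_min_symmetric)
next
  assume "h \<le> a"
  then have M: "plateau_start a h = a * h / 2" using plateau_start_eq[OF assms(1), of h] by simp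
  show "strict_antimono_on {0<..a * h / 2} (\<lambda>L. F_min a h L)"
    using strict_antimono_on_F_min[OF assms] unfolding M .
  show "strict_mono_on {a * h / 2..<a * h} (\<lambda>L. F_min a h L)"
    using strict_mono_on_F_min[OF assms] unfolding M by simp
  show "(\<lambda>L. F_min a h L) ` {0<..<a * h} = {h ^ 3 / (a\<^sup>2 + h\<^sup>2)..<h}"
    using F_min_image[OF assms] F_min_at_min(1)[OF assms] \<open>h \<le> a\<close> by simp
next
  assume "h > a"
  then have M: "plateau_start a h = a\<^sup>2 / 2" using plateau_start_eq[OF assms(1), of h] by simp
  show "strict_antimono_on {0<..a\<^sup>2 / 2} (\<lambda>L. F_min a h L)"
    using strict_antimono_on_F_min[OF assms] unfolding M .
  show "(\<lambda>L. F_min a h L) constant_on {a\<^sup>2 / 2..a * h - a\<^sup>2 / 2}"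
    unfolding constant_on_def
    by (intro exI[of _ "F_min a h (a\<^sup>2 / 2)"] ballI) (use F_min_plateau(1)[OF assms] M in \<open>metis atLeastAtMost_iff\<close>)
  show "strict_mono_on {a * h - a\<^sup>2 / 2..<a * h} (\<lambda>L. F_min a h L)"
    using strict_mono_on_F_min[OF assms] unfolding M .
  show "(\<lambda>L. F_min a h L) ` {0<..<a * h} = {h - a / 2..<h}"
    using F_min_image[OF assms] F_min_at_min(1)[OF assms] \<open>h > a\<close> by simp
qed

end
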